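(* Let $t_0\in\mathbb{R}$, $T\in(\mathbb{R}\setminus\{t_0\})\cup\{\pm\infty\}$, let $\mathcal{P}$ be the open segment of the real axis between $t_0$ and $T$, and let $\varphi:\mathcal{P}\to(0,\infty)$ and $a:\mathcal{P}\to\mathbb{C}$ be continuous functions satisfying the factorization condition (F) of the context. Let $r_0$, $\chi_n$, $\operatorname{c}_{\mathcal{P}}(n)$, $\operatorname{C}_{\mathcal{P}}(t,N)$, $\varphi_{\mathcal{P}}$, $\omega_{\mathcal{P}}$ be as in the context. Then, for each $0<r<r_0$ and $N\in\mathbb{N}$, the function $$\mathcal{M}_{\varphi,\mathcal{P}_r}\{a\}(z):=\int_{\mathcal{P}_r}\{\varphi(t)\}^{-z}a(t)\,dt,$$ defined by this integral for $\Re z<\Re\chi_0$, can be continued to a meromorphic function in the half plane $\Re z<\Re\chi_N$ through the expansion $$\mathcal{M}_{\varphi,\mathcal{P}_r}\{a\}(z)=-e^{i\omega_{\mathcal{P}}}\sum_{n=0}^{N-1}\operatorname{c}_{\mathcal{P}}(n)\frac{\{\varphi(\tau_r)\}^{\chi_n-z}}{z-\chi_n}+\mathcal{M}^{N}_{\varphi,\mathcal{P}_r}\{a\}(z),$$ where $\tau_r$ is the endpoint of $\mathcal{P}_r$ different from $t_0$ and $$\mathcal{M}^{N}_{\varphi,\mathcal{P}_r}\{a\}(z):=\int_{\mathcal{P}_r}\{\varphi(t)\}^{-z}\{\varphi_{\mathcal{P}}(t)\}^{\beta_0(\chi_0-1)}\operatorname{C}_{\mathcal{P}}(t,N)\,\varphi'(t)\,dt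 .$$ In the half plane $\Re z<\Re\chi_N$ the only possible singularities are the simple poles $\chi_n$, $0\le n\le N-1$, with residues $$\operatorname*{Res}_{z=\chi_n}\mathcal{M}_{\varphi,\mathcal{P}_r}\{a\}(z)=-e^{i\omega_{\mathcal{P}}}\operatorname{c}_{\mathcal{P}}(n)\qquad(0\le n\le N-1).$$ Lastly, $\mathcal{M}_{\varphi,\mathcal{P}_r}\{a\}(z)=\mathcal{O}(|z|^{-1})$, as $\Im z\to\pm\infty$, in the half plane $\Re z<\Re\chi_N$.
   Context: Conventions. Integrals over subsets of $\mathcal{P}$ are with respect to $dt$ on the real line. $\omega_{\mathcal{P}}:=0$ if $T>t_0$, $\omega_{\mathcal{P}}:=\pi$ if $T<t_0$. $D_\rho(t_0)=\{t\in\mathbb{C}:|t-t_0|<\rho\}$, $\Gamma_\rho(t_0)$ is its counterclockwise oriented boundary circle, $\mathcal{P}_\rho:=\mathcal{P}\cap D_\rho(t_0)$. Powers of $\varphi(t)>0$ are taken with $\arg\varphi(t)=0$. $\varphi(\tau_r)$ is understood as $\lim_{t\to\tau_r,\,t\in\mathcal{P}_r}\varphi(t)$. Condition (F). There exists $R>0$ with $\varphi(t)>0$ for $t\in\mathcal{P}_R$, and there exist $\alpha_0\in\mathbb{C}$ with $\Re\alpha_0>-1$, $\beta_0>0$, and analytic functions $q,p:D_R(t_0)\to\mathbb{C}$ with $p(t_0)\ne0$, such that $$a(t)=(t-t_0)^{\alpha_0}q(t),\qquad\varphi(t)=(t-t_0)^{\beta_0}p(t)\qquad(t\in\mathcal{P}_R\cup\{t_0\}),$$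 where $(t-t_0)^\gamma=|t-t_0|^\gamma e^{i\gamma\omega_{\mathcal{P}}}$ for $t\in\mathcal{P}_R$, and at $t=t_0$ both sides are understood through the limit $t\to t_0$ along $\mathcal{P}$. Derived objects. For $n\in\mathbb{N}_0$ let $\chi_n:=\frac{\alpha_0+1+n}{\beta_0}$. Powers of $p$ use the branch with $\{p(t)\}^\kappa=|p(t)|^\kappa e^{-i\kappa\beta_0\omega_{\mathcal{P}}}$ for $t\in\mathcal{P}_R\cup\{t_0\}$. Let $0<r_p<R$ be such that $p$ has no zeros in $D_{r_p}(t_0)$, so that $\{p(t)\}^\kappa$ extends analytically to $D_{r_p}(t_0)$ for all $\kappa\in\mathbb{C}$. Put $$\varphi_{\mathcal{P}}(t):=(t-t_0)\{p(t)\}^{1/\beta_0},\qquad t\in D_{r_p}(t_0),$$ which is analytic, with $\varphi_{\mathcal{P}}(t_0)=0$, $\varphi_{\mathcal{P}}'(t_0)\neq0$, and satisfies $\varphi_{\mathcal{P}}(t)=\{\varphi(t)\}^{1/\beta_0}>0$ on $\mathcal{P}_{r_p}$. Let $0<r_\varphi\le r_p$ be such that $\varphi_{\mathcal{P}}$ is one-to-one on $D_{r_\varphi}(t_0)$. Put $b(t):=\beta_0p(t)+(t-t_0)p'(t)$ and let $0<r_b<R$ be such that $b$ has no zeros in $D_{r_b}(t_0)$. Fix $0<r_0<\min\{r_p,r_b,r_\varphi\}$. Define, for $n\in\mathbb{N}_0$, $$\operatorname{c}_{\mathcal{P}}(n):=\frac1{\beta_0}\frac1{2\pi i}\oint_{\Gamma_{r_0}(t_0)}\frac{q(w)}{\{p(w)\}^{\alpha_0/\beta_0}}\frac{dw}{\{\varphi_{\mathcal{P}}(w)\}^{n+1}}=\frac1{\beta_0}\frac1{n!}\frac{d^n}{dw^n}\frac{q(w)}{\{p(w)\}^{\chi_n}}\Big|_{w=t_0},$$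 and, for $t\in\mathcal{P}_{r_0}$, $$\operatorname{C}_{\mathcal{P}}(t,N):=\{\varphi_{\mathcal{P}}(t)\}^N\frac1{\beta_0}\frac1{2\pi i}\oint_{\Gamma_{r_0}(t_0)}\frac{q(w)}{\{p(w)\}^{\alpha_0/\beta_0}\{\varphi_{\mathcal{P}}(w)\}^N}\frac{dw}{\varphi_{\mathcal{P}}(w)-\varphi_{\mathcal{P}}(t)}.$$ *)

theory Defs
  imports "HOL-Complex_Analysis.Complex_Analysis" "HOL-Library.Landau_Symbols"
begin

definition seg :: "real \<Rightarrow> ereal \<Rightarrow> real set" where
  "seg t0 T = einterval (min (ereal t0) T) (max (ereal t0) T)"

definition seg_disc :: "real \<Rightarrow> ereal \<Rightarrow> real \<Rightarrow> real set" where
  "seg_disc t0 T \<rho> = {t \<in> seg t0 T. \<bar>t - t0\<bar> < \<rho>}"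

abbreviation disc :: "real \<Rightarrow> real \<Rightarrow> complex set" where
  "disc t0 \<rho> \<equiv> ball (complex_of_real t0) \<rho>"

definition seg_arg :: "real \<Rightarrow> ereal \<Rightarrow> real" where
  "seg_arg t0 T = (if T > ereal t0 then 0 else pi)"

text \<open>The power \<open>(t - t0)\<^sup>\<gamma>\<close> along the segment, with argument \<^term>\<open>seg_arg t0 T\<close> of
  \<open>t - t0\<close>; this differs from \<open>powr\<close> only in spelling out the branch.\<close>

definition seg_power :: "real \<Rightarrow> ereal \<Rightarrow> complex \<Rightarrow> real \<Rightarrow> complex" where
  "seg_power t0 T \<gamma> t =
     (complex_of_real \<bar>t - t0\<bar> powr \<gamma>) * exp (\<i> * \<gamma> * complex_of_real (seg_arg t0 T))"

text \<open>Condition (F) with its data exposed. The functions \<open>a\<close> and \<open>\<phi>\<close> carry no values at \<open>t0\<close>: the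
  factorizations at \<open>t0\<close> are meant in the sense of limits along the segment and therefore follow
  from those on the segment.\<close>

definition condition_F ::
  "real \<Rightarrow> ereal \<Rightarrow> (real \<Rightarrow> real) \<Rightarrow> (real \<Rightarrow> complex) \<Rightarrow> real \<Rightarrow> complex \<Rightarrow> real \<Rightarrow>
   (complex \<Rightarrow> complex) \<Rightarrow> (complex \<Rightarrow> complex) \<Rightarrow> bool" where
  "condition_F t0 T \<phi> a R \<alpha>0 \<beta>0 q p \<longleftrightarrow>
     R > 0 \<and> (\<forall>t \<in> seg_disc t0 T R. \<phi> t > 0) \<and>
     Re \<alpha>0 > -1 \<and> \<beta>0 > 0 \<and>
     q analytic_on disc t0 R \<and> p analytic_on disc t0 R \<and> p (of_real t0) \<noteq> 0 \<and>
     (\<forall>t \<in> seg_disc t0 T R.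
        a t = seg_power t0 T \<alpha>0 t * q (of_real t) \<and>
        of_real (\<phi> t) = seg_power t0 T (of_real \<beta>0) t * p (of_real t))"

definition chi_exp :: "complex \<Rightarrow> real \<Rightarrow> nat \<Rightarrow> complex" where
  "chi_exp \<alpha>0 \<beta>0 n = (\<alpha>0 + 1 + of_nat n) / of_real \<beta>0"

text \<open>\<open>p_power t0 T \<beta>0 p rp \<kappa>\<close> is the branch of \<open>p\<^sup>\<kappa>\<close> on the disc of radius \<open>rp\<close>: the analytic
  function with the prescribed values on the segment and at \<open>t0\<close>. It exists when \<open>p\<close> has no
  zeros in the disc and \<open>\<phi>\<close> is positive on the segment, and its restriction to the disc is
  unique by the identity theorem; values outside the disc are unspecified.\<close>

definition p_power ::
  "real \<Rightarrow> ereal \<Rightarrow> real \<Rightarrow> (complex \<Rightarrow> complex) \<Rightarrow> real \<Rightarrow> complex \<Rightarrow> complex \<Rightarrow> complex" where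
  "p_power t0 T \<beta>0 p rp \<kappa> = (SOME f. f analytic_on disc t0 rp \<and>
     (\<forall>t \<in> insert t0 (seg_disc t0 T rp).
        f (of_real t) = (complex_of_real (norm (p (of_real t))) powr \<kappa>) *
          exp (- (\<i> * \<kappa> * of_real \<beta>0 * of_real (seg_arg t0 T)))))"

definition phi_P ::
  "real \<Rightarrow> ereal \<Rightarrow> real \<Rightarrow> (complex \<Rightarrow> complex) \<Rightarrow> real \<Rightarrow> complex \<Rightarrow> complex" where
  "phi_P t0 T \<beta>0 p rp w = (w - of_real t0) * p_power t0 T \<beta>0 p rp (1 / of_real \<beta>0) w"

definition b_fun :: "real \<Rightarrow> real \<Rightarrow> (complex \<Rightarrow> complex) \<Rightarrow> complex \<Rightarrow> complex" where
  "b_fun t0 \<beta>0 p w = of_real \<beta>0 * p w + (w - of_real t0) * deriv p w"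

definition coeff_c ::
  "real \<Rightarrow> ereal \<Rightarrow> complex \<Rightarrow> real \<Rightarrow> (complex \<Rightarrow> complex) \<Rightarrow> (complex \<Rightarrow> complex) \<Rightarrow>
   real \<Rightarrow> real \<Rightarrow> nat \<Rightarrow> complex" where
  "coeff_c t0 T \<alpha>0 \<beta>0 q p rp r0 n =
     1 / of_real \<beta>0 * (1 / (2 * of_real pi * \<i>)) *
     contour_integral (circlepath (of_real t0) r0)
       (\<lambda>w. q w / p_power t0 T \<beta>0 p rp (\<alpha>0 / of_real \<beta>0) w * (1 / phi_P t0 T \<beta>0 p rp w ^ (n + 1)))"

definition remainder_C ::
  "real \<Rightarrow> ereal \<Rightarrow> complex \<Rightarrow> real \<Rightarrow> (complex \<Rightarrow> complex) \<Rightarrow> (complex \<Rightarrow> complex) \<Rightarrow>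
   real \<Rightarrow> real \<Rightarrow> real \<Rightarrow> nat \<Rightarrow> complex" where
  "remainder_C t0 T \<alpha>0 \<beta>0 q p rp r0 t N =
     phi_P t0 T \<beta>0 p rp (of_real t) ^ N * (1 / of_real \<beta>0) * (1 / (2 * of_real pi * \<i>)) *
     contour_integral (circlepath (of_real t0) r0)
       (\<lambda>w. q w / (p_power t0 T \<beta>0 p rp (\<alpha>0 / of_real \<beta>0) w * phi_P t0 T \<beta>0 p rp w ^ N) *
            (1 / (phi_P t0 T \<beta>0 p rp w - phi_P t0 T \<beta>0 p rp (of_real t))))"

definition mellin_integrand :: "(real \<Rightarrow> real) \<Rightarrow> (real \<Rightarrow> complex) \<Rightarrow> complex \<Rightarrow> real \<Rightarrow> complex" where
  "mellin_integrand \<phi> a z t = (complex_of_real (\<phi> t) powr (-z)) * a t"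

definition mellin ::
  "real \<Rightarrow> ereal \<Rightarrow> (real \<Rightarrow> real) \<Rightarrow> (real \<Rightarrow> complex) \<Rightarrow> real \<Rightarrow> complex \<Rightarrow> complex" where
  "mellin t0 T \<phi> a r z = (LINT t : seg_disc t0 T r | lborel. mellin_integrand \<phi> a z t)"

definition mellin_rem_integrand ::
  "real \<Rightarrow> ereal \<Rightarrow> (real \<Rightarrow> real) \<Rightarrow> complex \<Rightarrow> real \<Rightarrow> (complex \<Rightarrow> complex) \<Rightarrow>
   (complex \<Rightarrow> complex) \<Rightarrow> real \<Rightarrow> real \<Rightarrow> nat \<Rightarrow> complex \<Rightarrow> real \<Rightarrow> complex" where
  "mellin_rem_integrand t0 T \<phi> \<alpha>0 \<beta>0 q p rp r0 N z t =
     (complex_of_real (\<phi> t) powr (-z)) *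
     (phi_P t0 T \<beta>0 p rp (of_real t) powr (of_real \<beta>0 * (chi_exp \<alpha>0 \<beta>0 0 - 1))) *
     remainder_C t0 T \<alpha>0 \<beta>0 q p rp r0 t N * of_real (deriv \<phi> t)"

definition mellin_rem ::
  "real \<Rightarrow> ereal \<Rightarrow> (real \<Rightarrow> real) \<Rightarrow> complex \<Rightarrow> real \<Rightarrow> (complex \<Rightarrow> complex) \<Rightarrow>
   (complex \<Rightarrow> complex) \<Rightarrow> real \<Rightarrow> real \<Rightarrow> real \<Rightarrow> nat \<Rightarrow> complex \<Rightarrow> complex" where
  "mellin_rem t0 T \<phi> \<alpha>0 \<beta>0 q p rp r0 r N z =
     (LINT t : seg_disc t0 T r | lborel. mellin_rem_integrand t0 T \<phi> \<alpha>0 \<beta>0 q p rp r0 N z t)"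

definition end_pt :: "real \<Rightarrow> ereal \<Rightarrow> real \<Rightarrow> real" where
  "end_pt t0 T r = (if T > ereal t0 then Sup (seg_disc t0 T r) else Inf (seg_disc t0 T r))"

text \<open>The value of \<open>\<phi>\<close> at the endpoint is the one-sided limit from within the segment; the endpoint
  may be \<open>T\<close>, where \<open>\<phi>\<close> is not defined.\<close>

definition phi_end :: "real \<Rightarrow> ereal \<Rightarrow> (real \<Rightarrow> real) \<Rightarrow> real \<Rightarrow> real" where
  "phi_end t0 T \<phi> r = Lim (at (end_pt t0 T r) within seg_disc t0 T r) \<phi>"

end

theory Submission
  imports Defs
begin

text \<open>
The idea is to use \<open>s = \<phi>\<^sub>P(t)\<close> as the variable of integration. It is a real positive coordinate on the
segment in which \<open>\<phi> = s\<^sup>\<beta>\<close>, and \<open>a dt\<close> becomes \<open>s\<^sup>\<alpha> h(s) ds\<close> with \<open>h\<close> holomorphic near \<open>0\<close>. The Taylor coefficients of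
\<open>h\<close> are \<open>\<beta> c(n)\<close> and its \<open>N\<close>-th Taylor remainder is \<open>\<beta> C(t, N)\<close>; both follow from Cauchy's formula for the
inverse of \<open>\<phi>\<^sub>P\<close> after expanding its kernel as a finite geometric sum (\<open>lagrange_expansion\<close>). Each Taylor
term integrates to a multiple of \<open>S\<^sup>\<beta>\<^sup>(\<^sup>\<chi>\<^sup>-\<^sup>z\<^sup>) / (z - \<chi>)\<close> with \<open>S = s(l)\<close> the value at the far end of the
segment, which is a simple pole at \<open>\<chi> = \<chi>\<^sub>n\<close>. The remainder term is an
integral of \<open>s\<^sup>\<beta>\<^sup>(\<^sup>\<chi>\<^sup>-\<^sup>z\<^sup>)\<^sup>-\<^sup>1\<close> with \<open>\<chi> = \<chi>\<^sub>N\<close>, convergent in the larger half plane.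

The remainder integral is integrated by parts once (\<open>power_integral_by_parts\<close>). This produces a factor
\<open>1 / (\<chi>\<^sub>N - z)\<close> times functions that are holomorphic in the half plane and bounded in vertical strips up to
the line \<open>Re z = Re \<chi>\<^sub>N\<close>, whence both the analyticity of the remainder
(\<open>power_integral_holomorphic\<close>) and the decay \<open>O(1 / \<bar>z\<bar>)\<close>.

The substitution itself is never carried out on integrals. The segment is parametrised affinely
by \<open>u = \<bar>t - t\<^sub>0\<bar>\<close>, and the locale \<open>power_substitution\<close> evaluates integrals of \<open>s' s\<^sup>\<gamma> E\<close> by the fundamental
theorem of calculus. The branches \<open>p\<^sup>\<kappa>\<close> are handled by a single logarithm that is real on the
segment (\<open>p_power_eq_exp_log\<close>), and \<open>phi_P_local_parametrisation\<close> collects the data in the variable \<open>u\<close>.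
\<close>

section \<open>Integrals of complex powers on a real interval\<close>

lemma set_integrable_lborel_boundI:
  fixes f :: "real \<Rightarrow> complex"
  assumes "continuous_on {a<..<b} f" "g integrable_on {a<..<b}"
    and "\<And>x. x \<in> {a<..<b} \<Longrightarrow> norm (f x) \<le> g x"
  shows "set_integrable lborel {a<..<b} f"
proof -
  have "f absolutely_integrable_on {a<..<b}"
    using assms
    by (intro measurable_bounded_by_integrable_imp_absolutely_integrable[where g = g]
        continuous_imp_measurable_on_sets_lebesgue) auto
  moreover have "(\<lambda>x. indicator {a<..<b} x *\<^sub>R f x) \<in> borel_measurable lborel"
    using borel_measurable_continuous_on_indicator[OF _ assms(1)] by simp
  ultimately show ?thesis
    by (simp add: set_integrable_def integrable_completion)
qed

lemma continuous_on_Icc_norm_bound: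
  fixes f :: "real \<Rightarrow> 'a::real_normed_vector"
  assumes "continuous_on {a..b} f"
  shows "\<exists>K. \<forall>u\<in>{a..b}. norm (f u) \<le> K"
  using compact_imp_bounded[OF compact_continuous_image[OF assms]]
  unfolding bounded_iff by (metis compact_Icc imageI)

text \<open>The variable \<open>u\<close> runs over the segment, measured from its singular endpoint \<open>t\<^sub>0\<close>, and \<open>s\<close> is the
coordinate in which \<open>\<phi>\<close> is a pure power. Since every integrand carries the factor \<open>s'\<close>, integrals of
powers of \<open>s\<close> have explicit antiderivatives in \<open>u\<close>, and no change of variables is ever performed.
The sign condition on \<open>s'\<close> makes \<open>s' s\<^sup>c\<close> its own integrable majorant.\<close>

locale power_substitution =
  fixes s s' :: "real \<Rightarrow> real" and l :: real
  assumes l_pos: "0 < l" and s_0: "s 0 = 0"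
    and s_pos: "\<And>u. u \<in> {0<..l} \<Longrightarrow> 0 < s u"
    and s_deriv: "\<And>u. u \<in> {0..l} \<Longrightarrow> (s has_real_derivative s' u) (at u within {0..l})"
    and s'_cont: "continuous_on {0..l} s'"
    and s'_nonneg: "\<And>u. u \<in> {0..l} \<Longrightarrow> 0 \<le> s' u"
begin

lemma s_cont: "continuous_on {0..l} s"
  using s_deriv by (meson DERIV_continuous continuous_on_eq_continuous_within)

lemma s_nonneg: "u \<in> {0..l} \<Longrightarrow> 0 \<le> s u"
  using s_pos[of u] s_0 by (cases "u = 0") auto

lemma s_deriv_at: "u \<in> {0<..<l} \<Longrightarrow> (s has_real_derivative s' u) (at u)"
  using s_deriv[of u] by (auto simp: at_within_Icc_at)

lemma s_powr_cont: "0 < Re \<gamma> \<Longrightarrow> continuous_on {0..l} (\<lambda>u. complex_of_real (s u) powr \<gamma>)"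
  using s_nonneg by (intro continuous_intros s_cont) auto

lemma norm_s_powr: "u \<in> {0..l} \<Longrightarrow> norm (complex_of_real (s u) powr \<gamma>) = s u powr Re \<gamma>"
  using s_nonneg[of u] by (subst norm_powr_real_powr) auto

lemma integrable_real_power:
  assumes "-1 < c"
  shows "(\<lambda>u. s' u * s u powr c) integrable_on {0<..<l}"
proof -
  have "((\<lambda>u. s' u * s u powr c) has_integral
      (s l powr (c + 1) / (c + 1) - s 0 powr (c + 1) / (c + 1))) {0..l}"
  proof (rule fundamental_theorem_of_calculus_interior)
    show "continuous_on {0..l} (\<lambda>u. s u powr (c + 1) / (c + 1))"
      using assms s_nonneg s_cont by (intro continuous_intros continuous_on_powr') auto
    fix u assume u: "u \<in> {0<..<l}"
    have "((\<lambda>u. s u powr (c + 1) / (c + 1)) has_real_derivative s' u * s u powr c) (at u)"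
      using assms s_pos[of u] u by (auto intro!: derivative_eq_intros s_deriv_at)
    then show "((\<lambda>u. s u powr (c + 1) / (c + 1)) has_vector_derivative s' u * s u powr c) (at u)"
      by (simp add: has_real_derivative_iff_has_vector_derivative)
  qed (use l_pos in auto)
  then show ?thesis
    by (meson has_integral_Icc_iff_Ioo has_integral_integrable)
qed

lemma set_integrable_power:
  assumes "-1 < Re \<gamma>" "continuous_on {0..l} E"
  shows "set_integrable lborel {0<..<l} (\<lambda>u. of_real (s' u) * of_real (s u) powr \<gamma> * (E u :: complex))"
proof -
  obtain K where K: "\<And>u. u \<in> {0..l} \<Longrightarrow> norm (E u) \<le> K"
    using continuous_on_Icc_norm_bound[OF assms(2)] by blast
  show ?thesis
  proof (rule set_integrable_lborel_boundI)
    show "continuous_on {0<..<l} (\<lambda>u. of_real (s' u) * of_real (s u) powr \<gamma> * E u)"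
      using s_pos
      by (intro continuous_intros continuous_on_subset[OF assms(2)] continuous_on_subset[OF s_cont]
          continuous_on_subset[OF s'_cont]) (auto simp: less_le)
    show "(\<lambda>u. (s' u * s u powr Re \<gamma>) * K) integrable_on {0<..<l}"
      by (intro integrable_on_mult_left integrable_real_power assms)
    show "norm (of_real (s' u) * of_real (s u) powr \<gamma> * E u) \<le> s' u * s u powr Re \<gamma> * K"
      if "u \<in> {0<..<l}" for u
      using that s'_nonneg[of u] K[of u]
      by (auto simp: norm_mult norm_s_powr intro!: mult_left_mono)
  qed
qed

text \<open>Integration by parts exchanges the exponent \<open>\<gamma>\<close>, possibly singular at \<open>u = 0\<close>, for \<open>\<gamma> + 1\<close>, for which the
integrand is continuous up to the endpoint. The explicit factor \<open>\<gamma> + 1\<close> is what later yields decay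
like \<open>1 / \<bar>z\<bar>\<close> uniformly up to the boundary line of the half plane, where the left-hand integral
admits no uniform absolute bound.\<close>

lemma power_integral_by_parts:
  assumes \<gamma>: "-1 < Re \<gamma>"
    and E: "\<And>u. u \<in> {0..l} \<Longrightarrow> (E has_vector_derivative E' u) (at u within {0..l})"
    and E': "continuous_on {0..l} E'"
  shows "(\<gamma> + 1) * (LINT u:{0<..<l}|lborel. of_real (s' u) * of_real (s u) powr \<gamma> * (E u :: complex))
    = of_real (s l) powr (\<gamma> + 1) * E l - integral {0..l} (\<lambda>u. of_real (s u) powr (\<gamma> + 1) * E' u)"
proof -
  have contE: "continuous_on {0..l} E"
    using E by (meson continuous_on_eq_continuous_within has_vector_derivative_continuous)
  have \<gamma>0: "\<gamma> + 1 \<noteq> 0" using \<gamma> by (auto simp: complex_eq_iff)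
  let ?f = "\<lambda>u. of_real (s' u) * of_real (s u) powr \<gamma> * E u"
  let ?g = "\<lambda>u. of_real (s u) powr (\<gamma> + 1) * E' u"
  have sum: "((\<lambda>u. (\<gamma> + 1) * ?f u + ?g u) has_integral
     (of_real (s l) powr (\<gamma> + 1) * E l - of_real (s 0) powr (\<gamma> + 1) * E 0)) {0..l}"
  proof (rule fundamental_theorem_of_calculus_interior)
    show "continuous_on {0..l} (\<lambda>u. of_real (s u) powr (\<gamma> + 1) * E u)"
      using \<gamma> by (intro continuous_on_mult s_powr_cont contE) auto
    fix u assume u: "u \<in> {0<..<l}"
    have "((\<lambda>u. complex_of_real (s u)) has_vector_derivative of_real (s' u)) (at u)"
      by (intro has_vector_derivative_of_real)
        (use s_deriv_at[OF u] in \<open>simp add: has_real_derivative_iff_has_vector_derivative\<close>)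
    moreover have "((\<lambda>z. z powr (\<gamma> + 1)) has_field_derivative (\<gamma> + 1) * of_real (s u) powr (\<gamma> + 1 - 1))
       (at (complex_of_real (s u)))"
      using s_pos[of u] u by (intro has_field_derivative_powr) (auto simp: complex_nonpos_Reals_iff)
    ultimately have "((\<lambda>u. of_real (s u) powr (\<gamma> + 1)) has_vector_derivative
        of_real (s' u) * ((\<gamma> + 1) * of_real (s u) powr \<gamma>)) (at u)"
      using field_vector_diff_chain_at by (force simp: o_def)
    moreover have "(E has_vector_derivative E' u) (at u)"
      using E[of u] u by (auto simp: at_within_Icc_at)
    ultimately show "((\<lambda>u. of_real (s u) powr (\<gamma> + 1) * E u) has_vector_derivative
       (\<gamma> + 1) * ?f u + ?g u) (at u)"
      using has_vector_derivative_mult by (fastforce simp: algebra_simps)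
  qed (use l_pos in auto)
  have f: "(?f has_integral (LINT u:{0<..<l}|lborel. ?f u)) {0..l}"
    using set_borel_integral_eq_integral[OF set_integrable_power[OF \<gamma> contE]]
    by (intro has_integral_Icc_iff_Ioo[THEN iffD2]) (simp only: has_integral_iff)
  have g: "(?g has_integral integral {0..l} ?g) {0..l}"
    using \<gamma> by (intro integrable_integral integrable_continuous_real continuous_on_mult s_powr_cont E') auto
  show ?thesis
    using has_integral_unique[OF sum has_integral_add[OF has_integral_mult_right[OF f] g]]
    by (simp add: s_0 algebra_simps)
qed

lemma power_integral_divided:
  assumes "\<And>u. u \<in> {0..l} \<Longrightarrow> (E has_vector_derivative E' u) (at u within {0..l})"
    and "continuous_on {0..l} E'" and "0 < Re w"
  shows "(LINT u:{0<..<l}|lborel. of_real (s' u) * of_real (s u) powr (w - 1) * (E u :: complex))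
    = (of_real (s l) powr w * E l - integral {0..l} (\<lambda>u. of_real (s u) powr w * E' u)) / w"
  (is "?L = ?R / w")
proof -
  have "w \<noteq> 0" using assms(3) by auto
  then have "?L = w * ?L / w" by simp
  also have "w * ?L = ?R"
    using power_integral_by_parts[OF _ assms(1,2), of "w - 1"] assms(3) by simp
  finally show ?thesis .
qed

corollary power_integral_const:
  assumes \<gamma>: "-1 < Re \<gamma>"
  shows "(LINT u:{0<..<l}|lborel. of_real (s' u) * of_real (s u) powr \<gamma> :: complex)
    = of_real (s l) powr (\<gamma> + 1) / (\<gamma> + 1)"
proof -
  have "\<gamma> + 1 \<noteq> 0" using \<gamma> by (auto simp: complex_eq_iff)
  then show ?thesis
    using power_integral_by_parts[OF \<gamma>, of "\<lambda>_. 1" "\<lambda>_. 0"] by (simp add: field_simps)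
qed

lemma norm_s_powr_bound:
  obtains M where "1 \<le> M"
    "\<And>u \<gamma> B. u \<in> {0..l} \<Longrightarrow> 0 \<le> Re \<gamma> \<Longrightarrow> Re \<gamma> \<le> B \<Longrightarrow>
       norm (complex_of_real (s u) powr \<gamma>) \<le> M powr B"
proof -
  obtain K where K: "\<And>u. u \<in> {0..l} \<Longrightarrow> norm (s u) \<le> K"
    using continuous_on_Icc_norm_bound[OF s_cont] by blast
  show ?thesis
  proof (rule that[of "max 1 K"])
    fix u B and \<gamma> :: complex assume u: "u \<in> {0..l}" and \<gamma>: "0 \<le> Re \<gamma>" "Re \<gamma> \<le> B"
    have "norm (complex_of_real (s u) powr \<gamma>) = s u powr Re \<gamma>"
      by (rule norm_s_powr[OF u])
    also have "\<dots> \<le> max 1 K powr Re \<gamma>"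
      using K[OF u] \<gamma> s_nonneg[OF u] by (intro powr_mono2) auto
    also have "\<dots> \<le> max 1 K powr B"
      using \<gamma> by (intro powr_mono) auto
    finally show "norm (complex_of_real (s u) powr \<gamma>) \<le> max 1 K powr B" .
  qed auto
qed

text \<open>The upper limit \<open>\<delta>\<close> serves two purposes: for \<open>\<delta> = l\<close> this is the uniform bound in a vertical strip,
and for \<open>\<delta> \<rightarrow> 0\<close> it controls the error of cutting off the singular end of the interval.\<close>

lemma power_integral_bound:
  assumes k: "continuous_on {0..l} (k :: real \<Rightarrow> complex)"
  obtains C where "\<And>\<gamma> \<delta>. 0 < Re \<gamma> \<Longrightarrow> Re \<gamma> \<le> B \<Longrightarrow> 0 \<le> \<delta> \<Longrightarrow> \<delta> \<le> l \<Longrightarrow>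
      norm (integral {0..\<delta>} (\<lambda>u. of_real (s u) powr \<gamma> * k u)) \<le> C * \<delta>"
proof -
  obtain K where K: "\<And>u. u \<in> {0..l} \<Longrightarrow> norm (k u) \<le> K"
    using continuous_on_Icc_norm_bound[OF k] by blast
  obtain M where M: "1 \<le> M" "\<And>u \<gamma> B. u \<in> {0..l} \<Longrightarrow> 0 \<le> Re \<gamma> \<Longrightarrow> Re \<gamma> \<le> B \<Longrightarrow>
       norm (complex_of_real (s u) powr \<gamma>) \<le> M powr B"
    by (rule norm_s_powr_bound) blast
  show ?thesis
  proof (rule that[of "M powr B * K"])
    fix \<gamma> :: complex and \<delta> assume \<gamma>: "0 < Re \<gamma>" "Re \<gamma> \<le> B" and \<delta>: "0 \<le> \<delta>" "\<delta> \<le> l"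
    show "norm (integral {0..\<delta>} (\<lambda>u. of_real (s u) powr \<gamma> * k u)) \<le> M powr B * K * \<delta>"
    proof (rule integral_bound[where a = 0 and b = \<delta>, unfolded diff_zero])
      show "continuous_on {0..\<delta>} (\<lambda>u. of_real (s u) powr \<gamma> * k u)"
        using \<gamma> \<delta> by (intro continuous_on_mult continuous_on_subset[OF s_powr_cont]
          continuous_on_subset[OF k]) auto
      show "norm (of_real (s u) powr \<gamma> * k u) \<le> M powr B * K" if "u \<in> {0..\<delta>}" for u
        using that \<delta> \<gamma> K[of u] M(2)[of u \<gamma> B] by (auto simp: norm_mult intro!: mult_mono)
    qed (use \<delta> in auto)
  qed
qed

text \<open>For fixed \<open>u > 0\<close> the integrand is entire in \<open>\<gamma>\<close>, but its \<open>\<gamma>\<close>-derivative contains \<open>ln (s u)\<close>, which is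
unbounded as \<open>u \<rightarrow> 0\<close>. To stay away from this point, differentiation under the integral sign is
applied on \<open>[\<delta>, l]\<close> with \<open>\<delta> > 0\<close>; as
\<open>\<delta> \<rightarrow> 0\<close> these integrals converge locally uniformly, so the limit is holomorphic.\<close>

lemma power_integral_holomorphic:
  assumes k: "continuous_on {0..l} (k :: real \<Rightarrow> complex)"
  shows "(\<lambda>\<gamma>. integral {0..l} (\<lambda>u. of_real (s u) powr \<gamma> * k u)) holomorphic_on {\<gamma>. 0 < Re \<gamma>}"
proof (rule holomorphic_uniform_sequence)
  show "open {\<gamma>. 0 < Re \<gamma>}" by (rule open_halfspace_Re_gt)
  define f where "f = (\<lambda>n \<gamma>. integral (cbox (l / real (n + 2)) l) (\<lambda>u. complex_of_real (s u) powr \<gamma> * k u))"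
  have low: "0 < l / real (n + 2)" "l / real (n + 2) \<le> l" for n
    using l_pos by (auto simp: field_simps)
  show "f n holomorphic_on {\<gamma>. 0 < Re \<gamma>}" for n
    unfolding f_def
  proof (rule leibniz_rule_holomorphic)
    have pos: "0 < s u" if "u \<in> cbox (l / real (n + 2)) l" for u
      using that low[of n] by (intro s_pos) auto
    fix \<gamma> u assume "\<gamma> \<in> {\<gamma>. 0 < Re \<gamma>}" and u: "u \<in> cbox (l / real (n + 2)) l"
    show "((\<lambda>\<gamma>. complex_of_real (s u) powr \<gamma> * k u) has_field_derivative
       (Ln (complex_of_real (s u)) * complex_of_real (s u) powr \<gamma>) * k u) (at \<gamma> within {\<gamma>. 0 < Re \<gamma>})"
      using pos[OF u]
      by (intro DERIV_cmult_right has_field_derivative_at_within[OF has_field_derivative_powr_right]) auto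
  next
    fix \<gamma> :: complex assume "\<gamma> \<in> {\<gamma>. 0 < Re \<gamma>}"
    then show "(\<lambda>u. complex_of_real (s u) powr \<gamma> * k u) integrable_on cbox (l / real (n + 2)) l"
      using low[of n]
      by (intro integrable_continuous continuous_on_mult continuous_on_subset[OF s_powr_cont]
          continuous_on_subset[OF k]) auto
  next
    let ?S = "{\<gamma>. 0 < Re \<gamma>} \<times> cbox (l / real (n + 2)) l"
    have pos: "0 < s (snd x)" if "x \<in> ?S" for x
      using that low[of n] by (intro s_pos) auto
    have c: "continuous_on ?S (\<lambda>x. f (snd x))" if "continuous_on {0..l} f" for f :: "real \<Rightarrow> 'c::t2_space"
      using low[of n] by (intro continuous_on_compose2[OF that]) (auto intro!: continuous_intros)
    have "continuous_on ?S (\<lambda>x. Ln (complex_of_real (s (snd x))) * complex_of_real (s (snd x)) powr fst x * k (snd x))"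
      using pos by (intro continuous_intros c s_cont k) (force simp: complex_nonpos_Reals_iff less_le)+
    then show "continuous_on ?S (\<lambda>(\<gamma>, u). (Ln (complex_of_real (s u)) * complex_of_real (s u) powr \<gamma>) * k u)"
      by (simp add: case_prod_unfold)
  qed (auto simp: convex_halfspace_Re_gt)
  fix z assume z: "z \<in> {\<gamma>. 0 < Re \<gamma>}"
  define d where "d = Re z / 2"
  have near: "0 < Re \<gamma> \<and> Re \<gamma> \<le> 2 * Re z" if "\<gamma> \<in> cball z d" for \<gamma>
  proof -
    have "\<bar>Re (z - \<gamma>)\<bar> \<le> d"
      using that abs_Re_le_cmod[of "z - \<gamma>"] by (auto simp: dist_norm)
    then have "Re z - Re \<gamma> \<le> Re z / 2" "Re \<gamma> - Re z \<le> Re z / 2"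
      unfolding d_def abs_le_iff by auto
    then show ?thesis using z by simp
  qed
  obtain C where C: "\<And>\<gamma> \<delta>. 0 < Re \<gamma> \<Longrightarrow> Re \<gamma> \<le> 2 * Re z \<Longrightarrow> 0 \<le> \<delta> \<Longrightarrow> \<delta> \<le> l \<Longrightarrow>
      norm (integral {0..\<delta>} (\<lambda>u. of_real (s u) powr \<gamma> * k u)) \<le> C * \<delta>"
    using power_integral_bound[OF k] by blast
  have "uniform_limit (cball z d) f (\<lambda>\<gamma>. integral {0..l} (\<lambda>u. of_real (s u) powr \<gamma> * k u)) sequentially"
  proof (rule uniform_limit_iff[THEN iffD2], intro allI impI)
    fix e :: real assume "0 < e"
    have "(\<lambda>n. C * (l / real (n + 2))) \<longlonglongrightarrow> 0"
      using tendsto_mult_right_zero[OF LIMSEQ_ignore_initial_segment[OF lim_const_over_n, of l 2], of C]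
      by simp
    from tendstoD[OF this \<open>0 < e\<close>]
    show "\<forall>\<^sub>F n in sequentially. \<forall>\<gamma>\<in>cball z d.
        dist (f n \<gamma>) (integral {0..l} (\<lambda>u. of_real (s u) powr \<gamma> * k u)) < e"
    proof eventually_elim
      case (elim n)
      show ?case
      proof
        fix \<gamma> assume g: "\<gamma> \<in> cball z d"
        let ?h = "\<lambda>u. complex_of_real (s u) powr \<gamma> * k u" and ?\<delta> = "l / real (n + 2)"
        have "?h integrable_on {0..l}"
          using near[OF g] by (intro integrable_continuous_real continuous_on_mult s_powr_cont k) auto
        from Henstock_Kurzweil_Integration.integral_combine[OF _ _ this, of ?\<delta>] low[of n]
        have "integral {0..l} ?h = integral {0..?\<delta>} ?h + f n \<gamma>"
          by (simp add: f_def)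
        then have "dist (f n \<gamma>) (integral {0..l} ?h) = norm (integral {0..?\<delta>} ?h)"
          by (simp add: dist_norm norm_minus_commute)
        also have "\<dots> \<le> C * ?\<delta>"
          using near[OF g] low[of n] by (intro C) auto
        also have "\<dots> < e" using elim unfolding dist_real_def by linarith
        finally show "dist (f n \<gamma>) (integral {0..l} ?h) < e" .
      qed
    qed
  qed
  moreover have "cball z d \<subseteq> {\<gamma>. 0 < Re \<gamma>}" using near by auto
  ultimately show "\<exists>d. 0 < d \<and> cball z d \<subseteq> {\<gamma>. 0 < Re \<gamma>} \<and>
      uniform_limit (cball z d) f (\<lambda>\<gamma>. integral {0..l} (\<lambda>u. of_real (s u) powr \<gamma> * k u)) sequentially"
    using z by (intro exI[of _ d]) (auto simp: d_def)
qed

end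

section \<open>Cauchy integrals of univalent functions\<close>

text \<open>Dividing numerator and denominator by \<open>w - t\<close> turns this into Cauchy's formula for \<open>G / k\<close>, where \<open>k\<close> is the
difference quotient of \<open>f\<close> at \<open>t\<close>, completed by \<open>f' t\<close>; injectivity of \<open>f\<close> makes \<open>k\<close> zero-free.\<close>

lemma cauchy_integral_univalent:
  assumes f: "f holomorphic_on U" "open U" "inj_on f U" and G: "G holomorphic_on U"
    and U: "cball c r \<subseteq> U" and t: "t \<in> ball c r"
  shows "((\<lambda>w. G w / (f w - f t)) has_contour_integral 2 * of_real pi * \<i> * (G t / deriv f t))
     (circlepath c r)"
proof -
  define k where "k = (\<lambda>w. if w = t then deriv f t else (f w - f t) / (w - t))"
  have r: "0 < r" using t by (metis ball_eq_empty empty_iff not_less)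
  have tU: "t \<in> U" using t U by auto
  have k: "k holomorphic_on U" unfolding k_def by (rule pole_lemma_open[OF f(1,2)])
  have k0: "k w \<noteq> 0" if "w \<in> U" for w
    using that f(3) tU holomorphic_injective_imp_regular[OF f tU]
    by (auto simp: k_def inj_on_def)
  have "(\<lambda>w. G w / k w) holomorphic_on cball c r"
    using k0 U by (intro holomorphic_on_divide holomorphic_on_subset[OF G] holomorphic_on_subset[OF k]) auto
  from Cauchy_integral_circlepath_simple[OF this]
  have "((\<lambda>w. G w / k w / (w - t)) has_contour_integral 2 * of_real pi * \<i> * (G t / k t)) (circlepath c r)"
    using t by (simp add: dist_norm norm_minus_commute)
  moreover have "G w / k w / (w - t) = G w / (f w - f t)" if "w \<in> path_image (circlepath c r)" for w
    using that t r by (auto simp: k_def)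
  ultimately have "((\<lambda>w. G w / (f w - f t)) has_contour_integral 2 * of_real pi * \<i> * (G t / k t)) (circlepath c r)"
    by (rule has_contour_integral_eq)
  then show ?thesis by (simp add: k_def)
qed

text \<open>Injectivity keeps \<open>f w - f t\<close> away from zero for \<open>w\<close> on the circle and \<open>t\<close> inside, so one may differentiate
under the integral sign.\<close>

lemma holomorphic_cauchy_integral_univalent:
  assumes f: "f holomorphic_on U" "open U" "inj_on f U"
    and U: "cball c r \<subseteq> U" and r: "0 < r" and g: "continuous_on (sphere c r) g"
  shows "(\<lambda>t. contour_integral (circlepath c r) (\<lambda>w. g w * (1 / (f w - f t)))) holomorphic_on ball c r"
proof -
  define v where "v = (\<lambda>x. vector_derivative (circlepath c r) (at x))"
  have cf: "continuous_on U f" by (intro holomorphic_on_imp_continuous_on f)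
  have cf': "continuous_on U (deriv f)" by (intro holomorphic_on_imp_continuous_on holomorphic_deriv f)
  have cv: "continuous_on S v" for S
    unfolding v_def vector_derivative_circlepath by (intro continuous_intros)
  have \<gamma>: "circlepath c r x \<in> sphere c r" for x
    using r by (simp add: circlepath dist_norm norm_mult norm_exp_eq_Re)
  have c\<gamma>: "continuous_on S (circlepath c r)" for S
    unfolding circlepath by (intro continuous_intros)
  have neq: "f (circlepath c r x) - f t \<noteq> 0" if t: "t \<in> ball c r" for t x
  proof -
    have "circlepath c r x \<in> U" "t \<in> U" using \<gamma>[of x] t U by auto
    moreover have "circlepath c r x \<noteq> t" using \<gamma>[of x] t by auto
    ultimately show ?thesis using f(3) by (auto simp: inj_on_def)
  qed
  have c\<gamma>U: "continuous_on S (\<lambda>x. h (circlepath c r (k x)))"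
    if "continuous_on (sphere c r) h" "continuous_on S k" for h :: "complex \<Rightarrow> complex" and k S
  proof -
    have "continuous_on S (\<lambda>x. circlepath c r (k x))"
      by (rule continuous_on_compose2[OF c\<gamma>[of UNIV] that(2)]) auto
    then show ?thesis
      by (intro continuous_on_compose2[OF that(1)]) (use \<gamma> in auto)
  qed
  have cfs: "continuous_on (sphere c r) f" 
    by (rule continuous_on_subset[OF cf order_trans[OF sphere_cball U]])
  have "(\<lambda>t. integral (cbox 0 1) (\<lambda>x. g (circlepath c r x) * (1 / (f (circlepath c r x) - f t)) * v x))
     holomorphic_on ball c r"
  proof (rule leibniz_rule_holomorphic)
    fix t and x :: real assume t: "t \<in> ball c r"
    have "(f has_field_derivative deriv f t) (at t within ball c r)"
      by (rule has_field_derivative_at_within, rule holomorphic_derivI[OF f(1,2)]) (use t U in auto)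
    then show "((\<lambda>t. g (circlepath c r x) * (1 / (f (circlepath c r x) - f t)) * v x)
       has_field_derivative
       g (circlepath c r x) * (deriv f t / (f (circlepath c r x) - f t) ^ 2) * v x) (at t within ball c r)"
      using neq[OF t, of x]
      by (auto intro!: derivative_eq_intros simp: power2_eq_square)
  next
    fix t assume t: "t \<in> ball c r"
    show "(\<lambda>x. g (circlepath c r x) * (1 / (f (circlepath c r x) - f t)) * v x) integrable_on cbox 0 1"
      using neq[OF t]
      by (intro integrable_continuous continuous_intros cv c\<gamma>U[of _ _ "\<lambda>x. x"] g cfs) auto
  next
    have "continuous_on (ball c r \<times> cbox 0 1) (\<lambda>x. g (circlepath c r (snd x)) *
      (deriv f (fst x) / (f (circlepath c r (snd x)) - f (fst x)) ^ 2) * v (snd x))"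
      using neq U
      by (intro continuous_intros c\<gamma>U g cfs continuous_on_compose2[OF cf]
         continuous_on_compose2[OF cf'] continuous_on_compose2[OF cv[of UNIV]]) auto
    then show "continuous_on (ball c r \<times> cbox 0 1) (\<lambda>(t, x). g (circlepath c r x) *
      (deriv f t / (f (circlepath c r x) - f t) ^ 2) * v x)"
      by (simp add: case_prod_unfold)
  qed auto
  then show ?thesis by (simp add: contour_integral_integral v_def)
qed

lemma inverse_diff_geometric:
  fixes x y :: "'a::field"
  assumes "y \<noteq> 0" "y \<noteq> x"
  shows "1 / (y - x) = (\<Sum>n<N. x ^ n * (1 / y ^ (n + 1))) + x ^ N * (1 / y ^ N * (1 / (y - x)))"
proof (induction N)
  case (Suc N)
  have key: "1 / y ^ N * (1 / (y - x)) = 1 / y ^ (N + 1) + x * (1 / y ^ (N + 1) * (1 / (y - x)))"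
    using assms by (simp add: divide_simps)
  have "(\<Sum>n<Suc N. x ^ n * (1 / y ^ (n + 1))) + x ^ Suc N * (1 / y ^ Suc N * (1 / (y - x)))
      = (\<Sum>n<N. x ^ n * (1 / y ^ (n + 1))) +
        x ^ N * (1 / y ^ (N + 1) + x * (1 / y ^ (N + 1) * (1 / (y - x))))"
    by (simp add: distrib_left mult_ac)
  also have "\<dots> = 1 / (y - x)"
    unfolding key[symmetric] by (rule Suc[symmetric])
  finally show ?case ..
qed simp

text \<open>The Lagrange-Buermann expansion of \<open>G / f'\<close> in powers of \<open>f\<close>, with its remainder in integral form: expand the
kernel \<open>1 / (f w - f t)\<close> of the Cauchy integral as a finite geometric sum.\<close>

lemma lagrange_expansion:
  assumes f: "f holomorphic_on U" "open U" "inj_on f U" and G: "G holomorphic_on U"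
    and U: "cball c r \<subseteq> U" and r: "0 < r" and c: "f c = 0" and t: "t \<in> ball c r"
  shows "2 * of_real pi * \<i> * (G t / deriv f t) =
     (\<Sum>n<N. f t ^ n * contour_integral (circlepath c r) (\<lambda>w. G w * (1 / f w ^ (n + 1))))
     + f t ^ N * contour_integral (circlepath c r) (\<lambda>w. G w / f w ^ N * (1 / (f w - f t)))"
proof -
  have nz: "f w \<noteq> 0" "f w \<noteq> f t" "w \<in> U" if "w \<in> sphere c r" for w
  proof -
    have "w \<in> U" "c \<in> U" "t \<in> U" "w \<noteq> c" "w \<noteq> t" using that U r t by auto
    then show "f w \<noteq> 0" "f w \<noteq> f t" "w \<in> U" using f(3) c by (auto simp: inj_on_def)
  qed
  have cont: "continuous_on (sphere c r) f" "continuous_on (sphere c r) G"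
    using nz(3) by (auto intro!: continuous_on_subset[OF holomorphic_on_imp_continuous_on] f G)
  have "((\<lambda>w. G w * (1 / f w ^ (n + 1))) has_contour_integral
      contour_integral (circlepath c r) (\<lambda>w. G w * (1 / f w ^ (n + 1)))) (circlepath c r)" for n
    using nz r cont
    by (intro has_contour_integral_integral contour_integrable_continuous_circlepath continuous_intros) auto
  moreover have "((\<lambda>w. G w / f w ^ N * (1 / (f w - f t))) has_contour_integral
      contour_integral (circlepath c r) (\<lambda>w. G w / f w ^ N * (1 / (f w - f t)))) (circlepath c r)"
    using nz r cont
    by (intro has_contour_integral_integral contour_integrable_continuous_circlepath continuous_intros) auto
  ultimately have "((\<lambda>w. (\<Sum>n<N. f t ^ n * (G w * (1 / f w ^ (n + 1)))) +
        f t ^ N * (G w / f w ^ N * (1 / (f w - f t)))) has_contour_integral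
     (\<Sum>n<N. f t ^ n * contour_integral (circlepath c r) (\<lambda>w. G w * (1 / f w ^ (n + 1))))
     + f t ^ N * contour_integral (circlepath c r) (\<lambda>w. G w / f w ^ N * (1 / (f w - f t)))) (circlepath c r)"
    by (intro has_contour_integral_add has_contour_integral_sum has_contour_integral_lmul) auto
  moreover have "(\<Sum>n<N. f t ^ n * (G w * (1 / f w ^ (n + 1)))) +
        f t ^ N * (G w / f w ^ N * (1 / (f w - f t))) = G w / (f w - f t)"
    if "w \<in> path_image (circlepath c r)" for w
  proof -
    have fw: "f w \<noteq> 0" "f w \<noteq> f t" using nz that r by auto
    have "G w / (f w - f t) = G w * (1 / (f w - f t))" by simp
    also have "\<dots> = G w * ((\<Sum>n<N. f t ^ n * (1 / f w ^ (n + 1))) +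
        f t ^ N * (1 / f w ^ N * (1 / (f w - f t))))"
      by (rule arg_cong[OF inverse_diff_geometric[OF fw]])
    also have "\<dots> = (\<Sum>n<N. f t ^ n * (G w * (1 / f w ^ (n + 1)))) +
        f t ^ N * (G w / f w ^ N * (1 / (f w - f t)))"
      by (simp add: distrib_left sum_distrib_left mult_ac)
    finally show ?thesis ..
  qed
  ultimately have "((\<lambda>w. G w / (f w - f t)) has_contour_integral
     (\<Sum>n<N. f t ^ n * contour_integral (circlepath c r) (\<lambda>w. G w * (1 / f w ^ (n + 1))))
     + f t ^ N * contour_integral (circlepath c r) (\<lambda>w. G w / f w ^ N * (1 / (f w - f t)))) (circlepath c r)"
    by (rule has_contour_integral_eq)
  from contour_integral_unique[OF this] contour_integral_unique[OF cauchy_integral_univalent[OF f G U t]]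
  show ?thesis by simp
qed

section \<open>Sums of simple poles and decay in vertical strips\<close>

lemma analytic_off_simple_poles:
  fixes \<xi> :: "nat \<Rightarrow> complex" and A :: "nat \<Rightarrow> complex \<Rightarrow> complex"
  assumes H: "open H" and A: "\<And>n. n < N \<Longrightarrow> A n holomorphic_on H" and B: "B holomorphic_on H"
  shows "(\<lambda>z. (\<Sum>n<N. A n z / (z - \<xi> n)) + B z) analytic_on (H - \<xi> ` {..<N})"
proof -
  have "open (H - \<xi> ` {..<N})"
    using H by (intro open_Diff finite_imp_closed) auto
  moreover have "(\<lambda>z. (\<Sum>n<N. A n z / (z - \<xi> n)) + B z) holomorphic_on (H - \<xi> ` {..<N})"
    using A by (intro holomorphic_intros holomorphic_on_subset[OF B] holomorphic_on_subset[OF A]) auto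
  ultimately show ?thesis by (simp add: analytic_on_open)
qed

lemma meromorphic_simple_poles:
  fixes \<xi> :: "nat \<Rightarrow> complex" and A :: "nat \<Rightarrow> complex \<Rightarrow> complex"
  assumes H: "open H" and A: "\<And>n. n < N \<Longrightarrow> A n holomorphic_on H" and B: "B holomorphic_on H"
  shows "(\<lambda>z. (\<Sum>n<N. A n z / (z - \<xi> n)) + B z) meromorphic_on H"
  using A B H
  by (intro meromorphic_intros analytic_on_imp_meromorphic_on) (auto simp: analytic_on_open)

text \<open>Near \<open>\<xi> m\<close> all other summands are holomorphic. If the numerator vanishes at \<open>\<xi> m\<close> the singularity is
removable, so whenever there is a pole it is simple.\<close>

lemma simple_pole_of_sum:
  fixes \<xi> :: "nat \<Rightarrow> complex" and A :: "nat \<Rightarrow> complex \<Rightarrow> complex"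
  assumes H: "open H" and A: "\<And>n. n < N \<Longrightarrow> A n holomorphic_on H" and B: "B holomorphic_on H"
    and \<xi>: "inj \<xi>" and m: "m < N" "\<xi> m \<in> H"
  defines "F \<equiv> (\<lambda>z. (\<Sum>n<N. A n z / (z - \<xi> n)) + B z)"
  shows "residue F (\<xi> m) = A m (\<xi> m)" "is_pole F (\<xi> m) \<Longrightarrow> zorder F (\<xi> m) = -1"
proof -
  define S where "S = H - \<xi> ` ({..<N} - {m})"
  define C where "C = (\<lambda>z. (\<Sum>n\<in>{..<N} - {m}. A n z / (z - \<xi> n)) + B z)"
  have S: "open S" unfolding S_def using H by (intro open_Diff finite_imp_closed) auto
  have mS: "\<xi> m \<in> S" using m \<xi> by (auto simp: S_def inj_on_def)
  have AS: "A m holomorphic_on S" using A[OF m(1)] by (rule holomorphic_on_subset) (auto simp: S_def)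
  have CS: "C holomorphic_on S" unfolding C_def S_def
    using A by (intro holomorphic_intros holomorphic_on_subset[OF B] holomorphic_on_subset[OF A]) auto
  have F: "F = (\<lambda>z. A m z / (z - \<xi> m) + C z)"
    using m by (auto simp: F_def C_def sum.remove[of "{..<N}" m] add_ac)
  have "(\<lambda>z. A m z / (z - \<xi> m)) holomorphic_on S - {\<xi> m}"
    by (intro holomorphic_intros holomorphic_on_subset[OF AS]) auto
  then show "residue F (\<xi> m) = A m (\<xi> m)"
    unfolding F using residue_add[OF S mS _ holomorphic_on_subset[OF CS]]
      residue_simple[OF S mS AS] residue_holo[OF S mS CS] by auto
  assume pole: "is_pole F (\<xi> m)"
  have nz: "A m (\<xi> m) \<noteq> 0"
  proof
    assume A0: "A m (\<xi> m) = 0"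
    have "((\<lambda>z. A m z / (z - \<xi> m)) \<longlongrightarrow> deriv (A m) (\<xi> m)) (at (\<xi> m))"
      using holomorphic_derivI[OF AS S mS] A0 by (simp add: has_field_derivative_iff)
    moreover have "(C \<longlongrightarrow> C (\<xi> m)) (at (\<xi> m))"
      using holomorphic_on_imp_continuous_on[OF CS] S mS
      by (metis continuous_on_eq_continuous_at continuous_within)
    ultimately have "(F \<longlongrightarrow> deriv (A m) (\<xi> m) + C (\<xi> m)) (at (\<xi> m))"
      unfolding F by (rule tendsto_add)
    with pole show False
      unfolding is_pole_def using not_tendsto_and_filterlim_at_infinity at_neq_bot by blast
  qed
  show "zorder F (\<xi> m) = -1"
  proof (rule zorder_eqI[OF S mS])
    show "(\<lambda>z. A m z + C z * (z - \<xi> m)) holomorphic_on S" by (intro holomorphic_intros AS CS)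
    show "F w = (A m w + C w * (w - \<xi> m)) * (w - \<xi> m) powi -1" if "w \<noteq> \<xi> m" for w
      using that by (simp add: F field_simps)
  qed (use nz in auto)
qed

text \<open>The filter of points tending to either end of the vertical strip \<open>\<sigma> \<le> Re z < x\<close>.\<close>

abbreviation (input) strip_ends :: "real \<Rightarrow> real \<Rightarrow> complex filter" where
  "strip_ends \<sigma> x \<equiv> inf (filtercomap (\<lambda>z. \<bar>Im z\<bar>) at_top) (principal {z. \<sigma> \<le> Re z \<and> Re z < x})"

lemma bigo_divide_shift:
  assumes "\<And>z. \<sigma> \<le> Re z \<Longrightarrow> Re z < x \<Longrightarrow> z \<noteq> c \<Longrightarrow> norm (f z) \<le> C / norm (z - c)"
  shows "(\<lambda>z. norm (f z)) \<in> O[strip_ends \<sigma> x](\<lambda>z. 1 / norm z)"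
proof (rule bigoI[where c = "2 * \<bar>C\<bar>"])
  have "norm (norm (f z)) \<le> 2 * \<bar>C\<bar> * norm (1 / norm z)"
    if z: "2 * norm c + 1 \<le> \<bar>Im z\<bar>" "\<sigma> \<le> Re z" "Re z < x" for z
  proof -
    \<comment> \<open>Far out in the strip \<open>\<bar>z\<bar> \<ge> 2 \<bar>c\<bar>\<close>, so \<open>\<bar>z - c\<bar>\<close> and \<open>\<bar>z\<bar>\<close> are comparable.\<close>
    have "2 * norm c + 1 \<le> norm z" using z(1) abs_Im_le_cmod[of z] by linarith
    moreover have "norm z - norm c \<le> norm (z - c)" by (rule norm_triangle_ineq2)
    ultimately have n: "0 < norm z" "norm z / 2 \<le> norm (z - c)" "z \<noteq> c"
      using norm_ge_zero[of c] by (linarith, linarith, smt (verit))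
    have "norm (f z) \<le> C / norm (z - c)" using assms[OF z(2,3) n(3)] .
    also have "\<dots> \<le> \<bar>C\<bar> / norm (z - c)" by (intro divide_right_mono) auto
    also have "\<dots> \<le> \<bar>C\<bar> / (norm z / 2)" using n by (intro divide_left_mono) auto
    finally show ?thesis by (simp add: mult_ac)
  qed
  then show "\<forall>\<^sub>F z in strip_ends \<sigma> x. norm (norm (f z)) \<le> 2 * \<bar>C\<bar> * norm (1 / norm z)"
    unfolding eventually_inf_principal eventually_filtercomap_at_top_linorder by blast
qed

lemma bigo_norm_add:
  fixes f g :: "'a \<Rightarrow> complex"
  assumes "(\<lambda>z. norm (f z)) \<in> O[F](h)" "(\<lambda>z. norm (g z)) \<in> O[F](h)"
  shows "(\<lambda>z. norm (f z + g z)) \<in> O[F](h :: _ \<Rightarrow> real)"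
  by (rule landau_o.big_trans[OF _ sum_in_bigo(1)[OF assms]])
    (auto intro!: bigoI[where c = 1] always_eventually norm_triangle_ineq)

lemma bigo_norm_sum:
  fixes f :: "'i \<Rightarrow> 'a \<Rightarrow> complex"
  assumes "finite I" "\<And>i. i \<in> I \<Longrightarrow> (\<lambda>z. norm (f i z)) \<in> O[F](h)"
  shows "(\<lambda>z. norm (\<Sum>i\<in>I. f i z)) \<in> O[F](h :: _ \<Rightarrow> real)"
  using assms by (induction I rule: finite_induct) (auto intro!: bigo_norm_add)

lemma norm_powr_bounded_strip:
  assumes "0 < b"
  obtains C where "\<And>z. \<sigma> \<le> Re z \<Longrightarrow> Re z < x \<Longrightarrow> norm (complex_of_real b powr (c - z)) \<le> C"
proof
  fix z :: complex assume z: "\<sigma> \<le> Re z" "Re z < x"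
  have "norm (complex_of_real b powr (c - z)) = b powr (Re c - Re z)"
    using assms by (subst norm_powr_real_powr) auto
  also have "\<dots> \<le> max 1 b powr (Re c - \<sigma>) + b powr (Re c - x)"
  proof (cases "1 \<le> b")
    case True
    then have "b powr (Re c - Re z) \<le> b powr (Re c - \<sigma>)" using z by (intro powr_mono) auto
    with True show ?thesis by (simp add: max_def add_increasing2)
  next
    case False
    then have "b powr (Re c - Re z) \<le> b powr (Re c - x)"
      using z assms by (intro powr_mono') auto
    then show ?thesis by (simp add: add_increasing)
  qed
  finally show "norm (complex_of_real b powr (c - z)) \<le> max 1 b powr (Re c - \<sigma>) + b powr (Re c - x)" .
qed

section \<open>The segment and the branches of powers of \<open>p\<close>\<close>

text \<open>The direction in which the segment leaves \<open>t\<^sub>0\<close>, that is \<open>e\<^sup>i\<^sup>\<omega>\<close>. The substitution \<open>t = t\<^sub>0 + e u\<close> with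
\<open>e = seg_sign t\<^sub>0 T\<close> treats both directions at once.\<close>

definition seg_sign :: "real \<Rightarrow> ereal \<Rightarrow> real" where
  "seg_sign t0 T = (if T > ereal t0 then 1 else -1)"

lemma exp_seg_arg: "exp (\<i> * complex_of_real (seg_arg t0 T)) = of_real (seg_sign t0 T)"
  by (simp add: seg_arg_def seg_sign_def)

lemma seg_disc_param:
  assumes "T \<noteq> ereal t0" "0 < \<rho>"
  obtains l where "0 < l" "l \<le> \<rho>" "\<And>t. t \<in> seg_disc t0 T \<rho> \<longleftrightarrow> seg_sign t0 T * (t - t0) \<in> {0<..<l}"
    "end_pt t0 T \<rho> = t0 + seg_sign t0 T * l"
proof (cases "T > ereal t0")
  case True
  obtain l where l: "0 < l" "l \<le> \<rho>" "seg_disc t0 T \<rho> = {t0<..<t0 + l}"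
  proof (cases T)
    case (real x)
    with True assms show ?thesis
      by (intro that[of "min \<rho> (x - t0)"])
        (auto simp: seg_disc_def seg_def einterval_def min_def max_def)
  qed (use True assms in \<open>auto intro!: that[of \<rho>] simp: seg_disc_def seg_def einterval_def min_def max_def\<close>)
  show ?thesis
    using True l by (intro that[of l]) (auto simp: seg_sign_def end_pt_def)
next
  case False
  then have *: "T < ereal t0" using assms(1) by auto
  obtain l where l: "0 < l" "l \<le> \<rho>" "seg_disc t0 T \<rho> = {t0 - l<..<t0}"
  proof (cases T)
    case (real x)
    with * assms show ?thesis
      by (intro that[of "min \<rho> (t0 - x)"])
        (auto simp: seg_disc_def seg_def einterval_def min_def max_def)
  qed (use * assms in \<open>auto intro!: that[of \<rho>] simp: seg_disc_def seg_def einterval_def min_def max_def\<close>)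
  show ?thesis
    using False l by (intro that[of l]) (auto simp: seg_sign_def end_pt_def)
qed

lemma set_integral_signed_shift:
  fixes f :: "real \<Rightarrow> complex"
  assumes "\<bar>e\<bar> = (1::real)" "\<And>t. t \<in> A \<longleftrightarrow> e * (t - c) \<in> B"
  shows "set_integrable lborel A f \<longleftrightarrow> set_integrable lborel B (\<lambda>u. f (c + e * u))"
    and "(LINT t:A|lborel. f t) = (LINT u:B|lborel. f (c + e * u))"
proof -
  have e: "e \<noteq> 0" "e * (e * u) = u" for u using assms(1) by (auto simp: abs_if split: if_splits)
  have ind: "indicator A (c + e * u) = (indicator B u :: real)" for u
    using assms(2)[of "c + e * u"] e by (simp add: indicator_def)
  show "set_integrable lborel A f \<longleftrightarrow> set_integrable lborel B (\<lambda>u. f (c + e * u))"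
    unfolding set_integrable_def
    by (subst lborel_integrable_real_affine_iff[OF e(1), of _ c, symmetric]) (simp add: ind)
  show "(LINT t:A|lborel. f t) = (LINT u:B|lborel. f (c + e * u))"
    unfolding set_lebesgue_integral_def
    by (subst lborel_integral_real_affine[OF e(1), of _ c]) (simp add: ind assms(1))
qed

text \<open>Any two logarithms of the positive function \<open>P\<close> on \<open>J\<close> differ by a continuous function with values in
\<open>2 \<pi> i \<int>\<close>, which is constant because \<open>J\<close> is connected; subtracting this constant makes the logarithm real on \<open>J\<close>.\<close>

lemma log_of_real_positive:
  assumes S: "convex S" "open S" and P: "P holomorphic_on S" "\<And>w. w \<in> S \<Longrightarrow> P w \<noteq> 0"
    and J: "connected J" "J \<subseteq> S" "x0 \<in> J" "\<And>x. x \<in> J \<Longrightarrow> P x = of_real (norm (P x))"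
  obtains K where "K holomorphic_on S" "\<And>w. w \<in> S \<Longrightarrow> exp (K w) = P w"
    "\<And>x. x \<in> J \<Longrightarrow> K x = of_real (ln (norm (P x)))"
proof -
  obtain k where k: "k holomorphic_on S" "\<And>w. w \<in> S \<Longrightarrow> exp (k w) = P w"
    using holomorphic_logarithm_exists[OF S P, of x0] J by auto
  define D where "D = (\<lambda>x. k x - of_real (ln (norm (P x))))"
  have eD: "exp (D x) = 1" if "x \<in> J" for x
  proof -
    have "exp (k x) = P x" "P x \<noteq> 0" using that J k P by auto
    moreover have "exp (complex_of_real (ln (norm (P x)))) = of_real (norm (P x))"
      using \<open>P x \<noteq> 0\<close> by (simp add: exp_of_real)
    ultimately show ?thesis using J(4)[OF that] by (simp add: D_def exp_diff)
  qed
  have "D constant_on J"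
  proof (rule continuous_discrete_range_constant[OF J(1)])
    have "continuous_on J k" "continuous_on J P"
      using k(1) P(1) J(2) by (auto intro: holomorphic_on_imp_continuous_on holomorphic_on_subset)
    then show "continuous_on J D"
      unfolding D_def using P(2) J(2) by (intro continuous_intros) auto
    fix x assume x: "x \<in> J"
    have "2 * pi \<le> norm (D y - D x)" if y: "y \<in> J" "D y \<noteq> D x" for y
    proof -
      have "exp (D y) = exp (D x)" using eD x y by simp
      then obtain n where n: "D y = D x + complex_of_real (of_int (2 * n) * pi) * \<i>"
        unfolding exp_eq by blast
      with y(2) have "n \<noteq> 0" by auto
      then have "1 \<le> \<bar>real_of_int n\<bar>" by linarith
      moreover have "norm (D y - D x) = 2 * \<bar>real_of_int n\<bar> * pi"
        unfolding n by (simp add: norm_mult)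
      ultimately show ?thesis using pi_gt_zero by simp
    qed
    then show "\<exists>e>0. \<forall>y. y \<in> J \<and> D y \<noteq> D x \<longrightarrow> e \<le> norm (D y - D x)"
      by (intro exI[of _ "2 * pi"]) auto
  qed
  then obtain c where c: "\<And>x. x \<in> J \<Longrightarrow> D x = c" by (auto simp: constant_on_def)
  have ec: "exp c = 1" using eD[OF J(3)] c[OF J(3)] by simp
  show ?thesis
  proof (rule that[of "\<lambda>w. k w - c"])
    show "(\<lambda>w. k w - c) holomorphic_on S" by (intro holomorphic_intros k)
    show "exp (k w - c) = P w" if "w \<in> S" for w using k(2)[OF that] ec by (simp add: exp_diff)
    show "k x - c = of_real (ln (norm (P x)))" if "x \<in> J" for x
      using c[OF that] by (simp add: D_def algebra_simps)
  qed
qed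

text \<open>Positivity of \<open>\<phi>\<close> says that \<open>p e\<^sup>i\<^sup>\<beta>\<^sup>\<omega>\<close> is positive on the segment. Hence all the branches \<open>p\<^sup>\<kappa>\<close> come from one
logarithm \<open>K\<close> of that function, chosen real on the segment; the identity theorem shows that the
choice in the definition of \<^const>\<open>p_power\<close> returns the corresponding exponential.\<close>

lemma p_power_eq_exp_log:
  assumes F: "condition_F t0 T \<phi> a R \<alpha>0 \<beta>0 q p" and T: "T \<noteq> ereal t0"
    and rp: "0 < rp" "rp < R" "\<forall>w \<in> disc t0 rp. p w \<noteq> 0"
  obtains K where "K holomorphic_on disc t0 rp"
    and "\<And>t. t \<in> insert t0 (seg_disc t0 T rp) \<Longrightarrow> K (of_real t) = of_real (ln (norm (p (of_real t))))"
    and "\<And>\<kappa> w. w \<in> disc t0 rp \<Longrightarrow>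
      p_power t0 T \<beta>0 p rp \<kappa> w = exp (\<kappa> * (K w - \<i> * of_real \<beta>0 * of_real (seg_arg t0 T)))"
proof -
  define e where "e = seg_sign t0 T"
  define P where "P = (\<lambda>w. p w * exp (\<i> * of_real \<beta>0 * of_real (seg_arg t0 T)))"
  obtain l where l: "0 < l" "l \<le> rp" "\<And>t. t \<in> seg_disc t0 T rp \<longleftrightarrow> e * (t - t0) \<in> {0<..<l}"
    using seg_disc_param[OF T rp(1)] unfolding e_def by metis
  have ee: "e * (e * u) = u" "\<bar>e\<bar> = 1" for u by (auto simp: e_def seg_sign_def)
  define g where "g = (\<lambda>u. complex_of_real (t0 + e * u))"
  define J where "J = g ` {0..<l}"
  have J: "J = of_real ` insert t0 (seg_disc t0 T rp)"
  proof -
    have "insert t0 (seg_disc t0 T rp) = (\<lambda>u. t0 + e * u) ` {0..<l}"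
    proof safe
      show "t0 \<in> (\<lambda>u. t0 + e * u) ` {0..<l}" using l by (intro image_eqI[of _ _ 0]) auto
      fix t assume "t \<in> seg_disc t0 T rp"
      then show "t \<in> (\<lambda>u. t0 + e * u) ` {0..<l}"
        using l(3)[of t] by (intro image_eqI[of _ _ "e * (t - t0)"]) (auto simp only: ee atLeastLessThan_iff greaterThanLessThan_iff)
    next
      fix u assume "u \<in> {0..<l}" "t0 + e * u \<notin> seg_disc t0 T rp"
      then show "t0 + e * u = t0" using l(3)[of "t0 + e * u"] ee by (cases "u = 0") auto
    qed
    then show ?thesis by (simp add: J_def g_def image_image)
  qed
  have gd: "g u \<in> disc t0 rp" if "u \<in> {0..<l}" for u
    using that l ee by (auto simp: g_def dist_norm abs_mult simp flip: of_real_mult)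
  have seg_R: "t \<in> seg_disc t0 T R" if "t \<in> seg_disc t0 T rp" for t
    using that rp by (auto simp: seg_disc_def)
  have hol_p: "p holomorphic_on disc t0 rp"
    using F rp unfolding condition_F_def
    by (meson analytic_imp_holomorphic holomorphic_on_subset subset_ball less_imp_le)
  then have P: "P holomorphic_on disc t0 rp" "\<And>w. w \<in> disc t0 rp \<Longrightarrow> P w \<noteq> 0"
    using rp by (auto simp: P_def intro!: holomorphic_intros)
  have nP: "norm (P w) = norm (p w)" for w
    by (simp add: P_def norm_mult norm_exp_eq_Re)
  have pos: "P (g u) = of_real (norm (P (g u)))" if u: "u \<in> {0<..<l}" for u
  proof -
    have t: "t0 + e * u \<in> seg_disc t0 T R" using seg_R l(3)[of "t0 + e * u"] u ee by auto
    with F have \<phi>: "\<phi> (t0 + e * u) > 0"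
      "of_real (\<phi> (t0 + e * u)) = seg_power t0 T (of_real \<beta>0) (t0 + e * u) * p (g u)"
      unfolding condition_F_def g_def by blast+
    have "seg_power t0 T (of_real \<beta>0) (t0 + e * u) * p (g u) = of_real (u powr \<beta>0) * P (g u)"
      using u ee by (simp add: seg_power_def P_def abs_mult powr_of_real mult_ac)
    with \<phi>(2) u have "P (g u) = of_real (\<phi> (t0 + e * u) / u powr \<beta>0)"
      by (simp add: field_simps)
    moreover have "\<phi> (t0 + e * u) / u powr \<beta>0 \<ge> 0" using \<phi>(1) by simp
    ultimately show ?thesis by (metis abs_of_nonneg norm_of_real)
  qed
  have real: "P x = of_real (norm (P x))" if x: "x \<in> J" for x
  proof -
    obtain u where u: "u \<in> {0..<l}" "x = g u" using x by (auto simp: J_def)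
    define m where "m = (u + l) / 2"
    have m: "0 < m" "m < l" "u \<le> m" using u by (auto simp: m_def)
    \<comment> \<open>Positivity at \<open>t\<^sub>0\<close> itself is inherited from the segment by continuity.\<close>
    have cl: "closure {0<..<m} = {0..m}" using m by (intro closure_greaterThanLessThan) auto
    have cont: "continuous_on {0..m} (\<lambda>u. P (g u))"
      using m gd by (intro continuous_on_compose2[OF holomorphic_on_imp_continuous_on[OF P(1)]])
         (auto simp: g_def intro!: continuous_intros)
    have "P (g u) - of_real (norm (P (g u))) = 0"
    proof (rule continuous_constant_on_closure[of "{0<..<m}" "\<lambda>u. P (g u) - of_real (norm (P (g u)))"])
      show "continuous_on (closure {0<..<m}) (\<lambda>u. P (g u) - of_real (norm (P (g u))))"
        unfolding cl by (intro continuous_on_diff continuous_on_of_real continuous_on_norm cont)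
      show "P (g v) - of_real (norm (P (g v))) = 0" if "v \<in> {0<..<m}" for v
        using pos[of v] that m by simp
      show "u \<in> closure {0<..<m}" unfolding cl using u m by simp
    qed
    then show ?thesis by (simp add: u)
  qed
  have "connected J" unfolding J_def g_def
    by (intro connected_continuous_image continuous_intros) auto
  moreover have "J \<subseteq> disc t0 rp" using gd by (auto simp: J_def)
  moreover have t0J: "of_real t0 \<in> J" unfolding J by simp
  ultimately obtain K where K: "K holomorphic_on disc t0 rp" "\<And>w. w \<in> disc t0 rp \<Longrightarrow> exp (K w) = P w"
    "\<And>x. x \<in> J \<Longrightarrow> K x = of_real (ln (norm (P x)))"
    using log_of_real_positive[OF convex_ball open_ball P _ _ _ real] by metis
  show ?thesis
  proof (rule that[OF K(1)])
    show Kt: "K (of_real t) = of_real (ln (norm (p (of_real t))))"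
      if "t \<in> insert t0 (seg_disc t0 T rp)" for t
      using K(3)[of "of_real t"] that unfolding J nP by blast
    fix \<kappa> w assume w: "w \<in> disc t0 rp"
    define f where "f = (\<lambda>w. exp (\<kappa> * (K w - \<i> * of_real \<beta>0 * of_real (seg_arg t0 T))))"
    let ?Q = "\<lambda>f. f analytic_on disc t0 rp \<and>
     (\<forall>t \<in> insert t0 (seg_disc t0 T rp).
        f (of_real t) = (complex_of_real (norm (p (of_real t))) powr \<kappa>) *
          exp (- (\<i> * \<kappa> * of_real \<beta>0 * of_real (seg_arg t0 T))))"
    have f: "?Q f"
    proof (intro conjI ballI)
      show "f analytic_on disc t0 rp"
        unfolding f_def by (subst analytic_on_open) (auto intro!: holomorphic_intros K(1))
      fix t assume t: "t \<in> insert t0 (seg_disc t0 T rp)"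
      then have "of_real t \<in> J" unfolding J by blast
      then have "p (of_real t) \<noteq> 0" using rp(3) \<open>J \<subseteq> disc t0 rp\<close> by blast
      then show "f (of_real t) = (complex_of_real (norm (p (of_real t))) powr \<kappa>) *
          exp (- (\<i> * \<kappa> * of_real \<beta>0 * of_real (seg_arg t0 T)))"
        unfolding f_def Kt[OF t] by (simp add: powr_def Ln_of_real exp_diff exp_minus right_diff_distrib mult_ac field_simps)
    qed
    then have p: "?Q (p_power t0 T \<beta>0 p rp \<kappa>)"
      unfolding p_power_def by (rule someI[of ?Q])
    have "p_power t0 T \<beta>0 p rp \<kappa> w - f w = 0"
    proof (rule analytic_continuation[of "\<lambda>w. p_power t0 T \<beta>0 p rp \<kappa> w - f w" "disc t0 rp" J "of_real t0"])
      show "(\<lambda>w. p_power t0 T \<beta>0 p rp \<kappa> w - f w) holomorphic_on disc t0 rp"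
        using p f by (intro holomorphic_intros analytic_imp_holomorphic) auto
      show "p_power t0 T \<beta>0 p rp \<kappa> z - f z = 0" if "z \<in> J" for z
        using that p f unfolding J by auto
      show "of_real t0 islimpt J"
      proof (rule connected_imp_perfect[OF \<open>connected J\<close> t0J])
        have "g (l / 2) \<in> J" unfolding J_def by (rule imageI) (use l(1) in auto)
        moreover have "g (l / 2) \<noteq> of_real t0" using l(1) ee(2) by (auto simp: g_def)
        ultimately show "J \<noteq> {x}" for x using t0J by auto
      qed
    qed (use rp w \<open>J \<subseteq> disc t0 rp\<close> in auto)
    then show "p_power t0 T \<beta>0 p rp \<kappa> w = exp (\<kappa> * (K w - \<i> * of_real \<beta>0 * of_real (seg_arg t0 T)))"
      by (simp add: f_def)
  qed
qed

section \<open>The integrands in the variable \<open>u\<close>\<close>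

lemma of_real_powr_exp_ln: "0 < x \<Longrightarrow> complex_of_real x powr \<gamma> = exp (\<gamma> * of_real (ln x))"
  by (simp add: powr_def Ln_of_real)

text \<open>Everything the theorem needs, transported to the real interval \<open>{0<..<l}\<close>. The function \<open>s\<close> is \<open>\<phi>\<^sub>P\<close> along the
segment, so that \<open>\<phi> = s\<^sup>\<beta>\<close>. Moreover \<open>a\<close> is \<open>s\<^sup>\<alpha> G\<close> with \<open>G = q / p\<^sup>\<alpha>\<^sup>/\<^sup>\<beta>\<close>, and expanding \<open>G / \<phi>\<^sub>P'\<close> in powers of
\<open>\<phi>\<^sub>P\<close> by \<open>lagrange_expansion\<close> brings out the factor \<open>s'\<close> together with the coefficients \<open>c n\<close>. The
remainder coefficient \<open>D\<close> is the restriction of a holomorphic function, hence continuously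
differentiable up to the endpoints.\<close>

lemma phi_P_local_parametrisation:
  fixes N :: nat
  assumes T: "T \<noteq> ereal t0"
    and F: "condition_F t0 T \<phi> a R \<alpha>0 \<beta>0 q p"
    and rp: "0 < rp" "rp < R" "\<forall>w \<in> disc t0 rp. p w \<noteq> 0"
    and r\<phi>: "r\<phi> \<le> rp" "inj_on (phi_P t0 T \<beta>0 p rp) (disc t0 r\<phi>)"
    and r: "0 < r" "r < r0" "r0 < r\<phi>"
  obtains l s s' and D D' :: "real \<Rightarrow> complex" where "power_substitution s s' l"
    and "\<And>t. t \<in> seg_disc t0 T r \<longleftrightarrow> seg_sign t0 T * (t - t0) \<in> {0<..<l}"
    and "\<And>u. u \<in> {0..l} \<Longrightarrow> (D has_vector_derivative D' u) (at u within {0..l})"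
    and "continuous_on {0..l} D'"
    and "\<And>u. u \<in> {0<..<l} \<Longrightarrow> \<phi> (t0 + seg_sign t0 T * u) = s u powr \<beta>0"
    and "\<And>u. u \<in> {0<..<l} \<Longrightarrow> deriv \<phi> (t0 + seg_sign t0 T * u) =
           seg_sign t0 T * \<beta>0 * s u powr (\<beta>0 - 1) * s' u"
    and "\<And>u. u \<in> {0<..<l} \<Longrightarrow> phi_P t0 T \<beta>0 p rp (of_real (t0 + seg_sign t0 T * u)) = of_real (s u)"
    and "\<And>u. u \<in> {0<..<l} \<Longrightarrow> remainder_C t0 T \<alpha>0 \<beta>0 q p rp r0 (t0 + seg_sign t0 T * u) N =
           of_real (s u) ^ N * D u / of_real \<beta>0"
    and "\<And>u. u \<in> {0<..<l} \<Longrightarrow> a (t0 + seg_sign t0 T * u) =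
           of_real (s u) powr \<alpha>0 * (of_real (seg_sign t0 T) * of_real (s' u) *
             ((\<Sum>n<N. of_real \<beta>0 * coeff_c t0 T \<alpha>0 \<beta>0 q p rp r0 n * of_real (s u) ^ n)
              + of_real (s u) ^ N * D u))"
    and "phi_end t0 T \<phi> r = s l powr \<beta>0"
proof -
  define e where "e = seg_sign t0 T"
  define X where "X = phi_P t0 T \<beta>0 p rp"
  define G where "G = (\<lambda>w. q w / p_power t0 T \<beta>0 p rp (\<alpha>0 / of_real \<beta>0) w)"
  define g where "g = (\<lambda>u. complex_of_real (t0 + e * u))"
  have \<beta>0: "0 < \<beta>0" using F by (simp add: condition_F_def)
  have ee: "e * (e * u) = u" "\<bar>e\<bar> = 1" "complex_of_real e * (of_real e * w) = w" for u w
    by (auto simp: e_def seg_sign_def)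
  obtain l where l: "0 < l" "l \<le> r" "\<And>t. t \<in> seg_disc t0 T r \<longleftrightarrow> e * (t - t0) \<in> {0<..<l}"
    "end_pt t0 T r = t0 + e * l"
    using seg_disc_param[OF T r(1)] unfolding e_def by metis
  obtain K where K: "K holomorphic_on disc t0 rp"
    "\<And>t. t \<in> insert t0 (seg_disc t0 T rp) \<Longrightarrow> K (of_real t) = of_real (ln (norm (p (of_real t))))"
    "\<And>\<kappa> w. w \<in> disc t0 rp \<Longrightarrow>
      p_power t0 T \<beta>0 p rp \<kappa> w = exp (\<kappa> * (K w - \<i> * of_real \<beta>0 * of_real (seg_arg t0 T)))"
    using p_power_eq_exp_log[OF F T rp] by metis
  have gd: "g u \<in> disc t0 r0" "g u \<in> disc t0 r\<phi>" "g u \<in> disc t0 rp" if "u \<in> {0..l}" for u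
    using that l r r\<phi> ee by (auto simp: g_def dist_norm abs_mult simp flip: of_real_mult)
  have seg: "t0 + e * u \<in> seg_disc t0 T r" "t0 + e * u \<in> seg_disc t0 T rp" "t0 + e * u \<in> seg_disc t0 T R"
    if "u \<in> {0<..<l}" for u
    using that l(3)[of "t0 + e * u"] ee r r\<phi> rp by (auto simp: seg_disc_def)
  have ReK: "K (g u) = of_real (Re (K (g u)))" if u: "u \<in> {0..l}" for u
  proof -
    \<comment> \<open>The end point \<open>u = l\<close> may correspond to \<open>T\<close>, which is outside the segment, so continuity is used there.\<close>
    have cl: "closure {0<..<l} = {0..l}" using l by (intro closure_greaterThanLessThan) auto
    have "continuous_on {0..l} (\<lambda>u. K (g u))"
      using gd(3) by (intro continuous_on_compose2[OF holomorphic_on_imp_continuous_on[OF K(1)]])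
         (auto simp: g_def intro!: continuous_intros)
    then have "continuous_on (closure {0<..<l}) (\<lambda>u. Im (K (g u)))"
      unfolding cl by (rule continuous_on_Im)
    moreover have "Im (K (g v)) = 0" if "v \<in> {0<..<l}" for v
      using K(2)[OF insertI2[OF seg(2)[OF that]]] unfolding g_def by simp
    ultimately have "Im (K (g u)) = 0"
      by (rule continuous_constant_on_closure) (assumption, unfold cl, rule u)
    then show ?thesis by (simp add: complex_eq_iff)
  qed
  define \<kappa> where "\<kappa> = (\<lambda>u. Re (K (g u)))"
  define s where "s = (\<lambda>u. u * exp (\<kappa> u / \<beta>0))"
  define s' where "s' = (\<lambda>u. Re (of_real e * deriv X (g u)))"
  have Xg: "X (g u) = of_real (s u)" if u: "u \<in> {0..l}" for u
  proof -
    have "X (g u) = of_real (e * u) * exp (1 / of_real \<beta>0 * (K (g u) - \<i> * of_real \<beta>0 * of_real (seg_arg t0 T)))"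
      unfolding X_def phi_P_def K(3)[OF gd(3)[OF u]] by (simp add: g_def)
    also have "1 / of_real \<beta>0 * (K (g u) - \<i> * of_real \<beta>0 * of_real (seg_arg t0 T)) =
        of_real (\<kappa> u / \<beta>0) - \<i> * of_real (seg_arg t0 T)"
      using \<beta>0 by (subst ReK[OF u]) (simp add: \<kappa>_def field_simps)
    also have "exp (of_real (\<kappa> u / \<beta>0) - \<i> * of_real (seg_arg t0 T)) = of_real (e * exp (\<kappa> u / \<beta>0))"
      unfolding exp_diff exp_seg_arg by (simp add: e_def seg_sign_def flip: exp_of_real)
    finally show ?thesis using ee by (simp add: s_def mult_ac flip: of_real_mult)
  qed
  have holp: "X holomorphic_on disc t0 rp"
  proof -
    have "(\<lambda>w. (w - of_real t0) * exp (1 / of_real \<beta>0 * (K w - \<i> * of_real \<beta>0 * of_real (seg_arg t0 T))))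
       holomorphic_on disc t0 rp"
      by (intro holomorphic_intros K(1))
    then show ?thesis
      by (rule holomorphic_transform) (simp add: X_def phi_P_def K(3))
  qed
  have X: "X holomorphic_on disc t0 r\<phi>" "inj_on X (disc t0 r\<phi>)"
    using holp r\<phi> by (auto simp: X_def intro: holomorphic_on_subset)
  have holq: "q holomorphic_on disc t0 rp"
    using F rp unfolding condition_F_def
    by (meson analytic_imp_holomorphic holomorphic_on_subset subset_ball less_imp_le)
  have G: "G holomorphic_on disc t0 r\<phi>"
  proof -
    have "(\<lambda>w. q w / exp (\<alpha>0 / of_real \<beta>0 * (K w - \<i> * of_real \<beta>0 * of_real (seg_arg t0 T))))
       holomorphic_on disc t0 rp"
      by (intro holomorphic_intros K(1) holq) auto
    then have "G holomorphic_on disc t0 rp"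
      by (rule holomorphic_transform) (simp add: G_def K(3))
    then show ?thesis using r\<phi> by (auto intro: holomorphic_on_subset)
  qed
  have dX: "deriv X w \<noteq> 0" if "w \<in> disc t0 r\<phi>" for w
    using holomorphic_injective_imp_regular[OF X(1) open_ball X(2) that] .
  have cdX: "continuous_on {0..l} (\<lambda>u. deriv X (g u))"
    using gd(2) by (intro continuous_on_compose2[OF holomorphic_on_imp_continuous_on[OF holomorphic_deriv[OF X(1) open_ball]]])
         (auto simp: g_def intro!: continuous_intros)
  have gv: "(g has_vector_derivative of_real e) (at u within S)" for u S
    unfolding g_def by (auto intro!: derivative_eq_intros has_vector_derivative_of_real
      simp: has_real_derivative_iff_has_vector_derivative[symmetric])
  have chain: "((\<lambda>u. h (g u)) has_vector_derivative of_real e * deriv h (g u)) (at u within {0..l})"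
    if "h holomorphic_on disc t0 r0" "u \<in> {0..l}" for h u
  proof -
    have "(h has_field_derivative deriv h (g u)) (at (g u))"
      using that gd by (intro holomorphic_derivI[OF that(1)]) auto
    then show ?thesis
      using field_vector_diff_chain_within[OF gv, of h "deriv h (g u)" u "{0..l}"]
      by (simp add: o_def has_field_derivative_at_within)
  qed
  have X0: "X holomorphic_on disc t0 r0" using X(1) r by (auto intro: holomorphic_on_subset)
  have sv: "(s has_vector_derivative s' u) (at u within {0..l})" if u: "u \<in> {0..l}" for u
  proof -
    have "((\<lambda>u. Re (X (g u))) has_vector_derivative s' u) (at u within {0..l})"
      using bounded_linear.has_vector_derivative[OF bounded_linear_Re chain[OF X0 u]]
      by (simp add: s'_def)
    then show ?thesis
      by (rule has_vector_derivative_transform[OF u, rotated]) (simp add: Xg)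
  qed
  have s'X: "of_real (s' u) = of_real e * deriv X (g u)" if u: "u \<in> {0..l}" for u
  proof (rule vector_derivative_unique_within_closed_interval[OF _ _, of 0 l u "\<lambda>u. X (g u)"])
    show "((\<lambda>u. X (g u)) has_vector_derivative of_real e * deriv X (g u)) (at u within cbox 0 l)"
      using chain[OF X0 u] by simp
    have "((\<lambda>u. complex_of_real (s u)) has_vector_derivative of_real (s' u)) (at u within {0..l})"
      by (intro has_vector_derivative_of_real)
        (use sv[OF u] in \<open>simp add: has_real_derivative_iff_has_vector_derivative\<close>)
    then show "((\<lambda>u. X (g u)) has_vector_derivative of_real (s' u)) (at u within cbox 0 l)"
      using has_vector_derivative_transform[OF u, of "\<lambda>u. X (g u)"] Xg by simp
  qed (use l u in auto)
  have s'_cont: "continuous_on {0..l} s'"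
    unfolding s'_def by (intro continuous_intros cdX)
  have s'_nz: "s' u \<noteq> 0" if "u \<in> {0..l}" for u
    using s'X[OF that] dX[OF gd(2)[OF that]] ee(2) by auto
  have s_pos: "0 < s u" if "u \<in> {0<..l}" for u using that by (simp add: s_def)
  have s'_nonneg: "0 \<le> s' u" if u: "u \<in> {0..l}" for u
  proof (rule ccontr)
    \<comment> \<open>Since \<open>s\<close> grows from \<open>0\<close> to \<open>s l > 0\<close>, its derivative is positive somewhere; a negative value elsewhere would force a zero, contrary to univalence.\<close>
    assume neg: "\<not> 0 \<le> s' u"
    obtain v where v: "v \<in> {0..l}" "s l - s 0 = s' v * l"
    proof -
      have "continuous_on {0..l} s"
        using sv by (meson continuous_on_eq_continuous_within has_vector_derivative_continuous)
      moreover have "(s has_derivative (\<lambda>h. h * s' v)) (at v)" if "0 < v" "v < l" for v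
        using sv[of v] that by (simp add: at_within_Icc_at has_vector_derivative_def)
      ultimately obtain v where "0 < v" "v < l" "s l - s 0 = (l - 0) * s' v"
        using mvt[of 0 l s "\<lambda>v h. h * s' v", OF l(1)] by blast
      then show thesis by (intro that[of v]) auto
    qed
    have "0 < s l - s 0" using s_pos[of l] l(1) by (simp add: s_def)
    then have "0 < s' v" unfolding v(2) using l(1) by (simp add: zero_less_mult_iff)
    moreover have "connected (s' ` {0..l})" by (intro connected_continuous_image s'_cont) auto
    ultimately have "0 \<in> s' ` {0..l}"
      using neg by (intro connectedD_interval[OF _ imageI[OF u] imageI[OF v(1)]]) auto
    then show False using s'_nz by auto
  qed
  have PS: "power_substitution s s' l"
    using l(1) s_pos s'_nonneg s'_cont sv
    by unfold_locales (auto simp: s_def has_real_derivative_iff_has_vector_derivative)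
  define D where "D = (\<lambda>t. 1 / (2 * of_real pi * \<i>) *
     contour_integral (circlepath (of_real t0) r0) (\<lambda>w. G w / X w ^ N * (1 / (X w - X t))))"
  have sub: "cball (complex_of_real t0) r0 \<subseteq> disc t0 r\<phi>" using r by auto
  have r0: "0 < r0" using r by auto
  have X00: "X (of_real t0) = 0" by (simp add: X_def phi_P_def)
  have holD: "D holomorphic_on disc t0 r0"
  proof -
    have "X w \<noteq> 0" if "w \<in> sphere (complex_of_real t0) r0" for w
    proof -
      have "w \<in> disc t0 r\<phi>" "complex_of_real t0 \<in> disc t0 r\<phi>" "w \<noteq> of_real t0" using that r by auto
      then show ?thesis using X(2) X00 by (auto simp: inj_on_def)
    qed
    moreover have "continuous_on (sphere (complex_of_real t0) r0) G" "continuous_on (sphere (complex_of_real t0) r0) X"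
      using r by (auto intro!: continuous_on_subset[OF holomorphic_on_imp_continuous_on[OF G]]
         continuous_on_subset[OF holomorphic_on_imp_continuous_on[OF X(1)]])
    ultimately show ?thesis
      unfolding D_def
      by (intro holomorphic_on_mult holomorphic_on_const
          holomorphic_cauchy_integral_univalent[OF X(1) open_ball X(2) sub r0] continuous_intros) auto
  qed
  show ?thesis
  proof (rule that[OF PS, folded e_def, of "\<lambda>u. D (g u)" "\<lambda>u. of_real e * deriv D (g u)"])
    show "t \<in> seg_disc t0 T r \<longleftrightarrow> e * (t - t0) \<in> {0<..<l}" for t by (rule l(3))
    show "((\<lambda>u. D (g u)) has_vector_derivative of_real e * deriv D (g u)) (at u within {0..l})"
      if "u \<in> {0..l}" for u by (rule chain[OF holD that])
    show "continuous_on {0..l} (\<lambda>u. of_real e * deriv D (g u))"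
      using gd(1) by (intro continuous_on_mult continuous_on_const
         continuous_on_compose2[OF holomorphic_on_imp_continuous_on[OF holomorphic_deriv[OF holD open_ball]]])
         (auto simp: g_def intro!: continuous_intros)
    have p_exp: "norm (p (g u)) = exp (\<kappa> u)" if u: "u \<in> {0<..<l}" for u
    proof -
      have "p (g u) \<noteq> 0" using rp(3) gd(3)[of u] u by auto
      moreover have "\<kappa> u = ln (norm (p (g u)))"
        using K(2)[OF insertI2[OF seg(2)[OF u]]] by (simp add: \<kappa>_def g_def)
      ultimately show ?thesis by simp
    qed
    show \<phi>s: "\<phi> (t0 + e * u) = s u powr \<beta>0" if u: "u \<in> {0<..<l}" for u
    proof -
      from F seg(3)[OF u] have \<phi>: "\<phi> (t0 + e * u) > 0"
        "of_real (\<phi> (t0 + e * u)) = seg_power t0 T (of_real \<beta>0) (t0 + e * u) * p (g u)"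
        unfolding condition_F_def g_def by blast+
      have "\<phi> (t0 + e * u) = norm (complex_of_real (\<phi> (t0 + e * u)))" using \<phi>(1) by simp
      also have "\<dots> = u powr \<beta>0 * exp (\<kappa> u)"
        unfolding \<phi>(2) norm_mult p_exp[OF u] using u ee
        by (simp add: seg_power_def norm_mult abs_mult powr_of_real norm_exp_eq_Re)
      also have "\<dots> = s u powr \<beta>0"
        using u \<beta>0 by (simp add: s_def powr_mult exp_powr_real)
      finally show ?thesis .
    qed
    show "deriv \<phi> (t0 + e * u) = e * \<beta>0 * s u powr (\<beta>0 - 1) * s' u" if u: "u \<in> {0<..<l}" for u
    proof (rule DERIV_imp_deriv)
      define t where "t = t0 + e * u"
      have eu: "e * (t - t0) = u" using ee(1) by (simp add: t_def)
      have su: "(s has_real_derivative s' u) (at u)"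
        using power_substitution.s_deriv_at[OF PS u] .
      have "((\<lambda>t. e * (t - t0)) has_real_derivative e) (at t)"
        by (auto intro!: derivative_eq_intros)
      then have "((\<lambda>t. s (e * (t - t0))) has_real_derivative s' u * e) (at t)"
        using su unfolding eu[symmetric] by (rule DERIV_chain2[rotated])
      then have d: "((\<lambda>t. s (e * (t - t0)) powr \<beta>0) has_real_derivative e * \<beta>0 * s u powr (\<beta>0 - 1) * s' u) (at t)"
        using s_pos[of u] u eu by (auto intro!: derivative_eq_intros simp: powr_diff field_simps)
      have ev: "\<forall>\<^sub>F x in nhds t. \<phi> x = s (e * (x - t0)) powr \<beta>0"
      proof -
        have "open {x. e * (x - t0) \<in> {0<..<l}}"
          unfolding greaterThanLessThan_iff
          by (intro open_Collect_conj open_Collect_less continuous_intros)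
        moreover have "\<phi> x = s (e * (x - t0)) powr \<beta>0" if "e * (x - t0) \<in> {0<..<l}" for x
          using \<phi>s[OF that] ee(1) by simp
        ultimately show ?thesis using eu u by (auto simp: eventually_nhds)
      qed
      from DERIV_cong_ev[OF refl ev refl] d
      show "(\<phi> has_real_derivative e * \<beta>0 * s u powr (\<beta>0 - 1) * s' u) (at (t0 + e * u))"
        unfolding t_def by (rule iffD2)
    qed
    show "phi_P t0 T \<beta>0 p rp (of_real (t0 + e * u)) = of_real (s u)" if u: "u \<in> {0<..<l}" for u
      using Xg[of u] u by (simp add: X_def g_def)
    show "remainder_C t0 T \<alpha>0 \<beta>0 q p rp r0 (t0 + e * u) N = of_real (s u) ^ N * D (g u) / of_real \<beta>0"
      if u: "u \<in> {0<..<l}" for u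
    proof -
      have u': "u \<in> {0..l}" using u by auto
      then have Xu: "X (of_real (t0 + e * u)) = of_real (s u)" using Xg by (simp add: g_def)
      show ?thesis
        unfolding remainder_C_def X_def[symmetric] D_def G_def Xg[OF u'] Xu
        by (simp add: mult_ac)
    qed
    show "a (t0 + e * u) = of_real (s u) powr \<alpha>0 * (of_real e * of_real (s' u) *
             ((\<Sum>n<N. of_real \<beta>0 * coeff_c t0 T \<alpha>0 \<beta>0 q p rp r0 n * of_real (s u) ^ n)
              + of_real (s u) ^ N * D (g u)))" if u: "u \<in> {0<..<l}" for u
    proof -
      have u': "u \<in> {0..l}" using u by auto
      have c: "of_real \<beta>0 * coeff_c t0 T \<alpha>0 \<beta>0 q p rp r0 n = 1 / (2 * of_real pi * \<i>) *
         contour_integral (circlepath (of_real t0) r0) (\<lambda>w. G w * (1 / X w ^ (n + 1)))" for n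
        using \<beta>0 unfolding coeff_c_def G_def X_def by simp
      have "2 * of_real pi * \<i> * (G (g u) / deriv X (g u)) = 2 * of_real pi * \<i> *
         ((\<Sum>n<N. of_real \<beta>0 * coeff_c t0 T \<alpha>0 \<beta>0 q p rp r0 n * of_real (s u) ^ n)
              + of_real (s u) ^ N * D (g u))"
        unfolding lagrange_expansion[OF X(1) open_ball X(2) G sub r0 X00 gd(1)[OF u'], of N] c D_def Xg[OF u']
        by (simp add: distrib_left sum_distrib_left mult_ac)
      then have "G (g u) / deriv X (g u) =
         ((\<Sum>n<N. of_real \<beta>0 * coeff_c t0 T \<alpha>0 \<beta>0 q p rp r0 n * of_real (s u) ^ n)
              + of_real (s u) ^ N * D (g u))" (is "_ = ?R")
        by (rule iffD1[OF mult_left_cancel, rotated]) simp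
      then have "G (g u) = deriv X (g u) * ?R"
        using dX[OF gd(2)[OF u']] by (simp add: divide_eq_eq mult_ac)
      also have "deriv X (g u) = of_real e * of_real (s' u)"
        unfolding s'X[OF u'] ee(3) ..
      finally have "G (g u) = of_real e * of_real (s' u) * ?R" .
      moreover have "a (t0 + e * u) = of_real (s u) powr \<alpha>0 * G (g u)"
      proof -
        have a: "a (t0 + e * u) = seg_power t0 T \<alpha>0 (t0 + e * u) * q (g u)"
          using F seg(3)[OF u] unfolding condition_F_def g_def by blast
        have sp: "seg_power t0 T \<alpha>0 (t0 + e * u) = exp (\<alpha>0 * of_real (ln u) + \<i> * \<alpha>0 * of_real (seg_arg t0 T))"
          using u ee(2) by (simp add: seg_power_def abs_mult of_real_powr_exp_ln exp_add)
        have "of_real (s u) powr \<alpha>0 = exp (\<alpha>0 * of_real (ln u + \<kappa> u / \<beta>0))"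
          using u by (subst of_real_powr_exp_ln) (auto simp: s_def ln_mult)
        moreover have "p_power t0 T \<beta>0 p rp (\<alpha>0 / of_real \<beta>0) (g u) =
            exp (\<alpha>0 / of_real \<beta>0 * (of_real (\<kappa> u) - \<i> * of_real \<beta>0 * of_real (seg_arg t0 T)))"
          using ReK[OF u'] unfolding K(3)[OF gd(3)[OF u']] \<kappa>_def by simp
        ultimately have "of_real (s u) powr \<alpha>0 * G (g u) = q (g u) *
          exp (\<alpha>0 * of_real (ln u + \<kappa> u / \<beta>0) - \<alpha>0 / of_real \<beta>0 * (of_real (\<kappa> u) - \<i> * of_real \<beta>0 * of_real (seg_arg t0 T)))"
          by (simp add: G_def exp_diff)
        also have "\<alpha>0 * of_real (ln u + \<kappa> u / \<beta>0) - \<alpha>0 / of_real \<beta>0 * (of_real (\<kappa> u) - \<i> * of_real \<beta>0 * of_real (seg_arg t0 T))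
           = \<alpha>0 * of_real (ln u) + \<i> * \<alpha>0 * of_real (seg_arg t0 T)"
          using \<beta>0 by (simp add: field_simps)
        finally show ?thesis unfolding a sp by (simp add: mult_ac)
      qed
      ultimately show ?thesis by simp
    qed
    show "phi_end t0 T \<phi> r = s l powr \<beta>0"
      unfolding phi_end_def l(4)
    proof (rule tendsto_Lim)
      have e1: "e = 1 \<or> e = -1" by (auto simp: e_def seg_sign_def)
      have segI: "seg_disc t0 T r = (if 0 < e then {t0<..<t0 + l} else {t0 - l<..<t0})"
      proof (rule set_eqI)
        show "x \<in> seg_disc t0 T r \<longleftrightarrow> x \<in> (if 0 < e then {t0<..<t0 + l} else {t0 - l<..<t0})" for x
          unfolding l(3) using e1 by auto
      qed
      show "\<not> trivial_limit (at (t0 + e * l) within seg_disc t0 T r)"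
        unfolding trivial_limit_within segI using l(1) e1
        by (auto simp: islimpt_greaterThanLessThan1 islimpt_greaterThanLessThan2)
      have c: "continuous_on {t. e * (t - t0) \<in> {0..l}} (\<lambda>t. s (e * (t - t0)))"
        by (intro continuous_on_compose2[OF power_substitution.s_cont[OF PS]] continuous_intros) auto
      have el: "e * (t0 + e * l - t0) = l"
        by (simp only: add_diff_cancel_left' ee(1))
      have "((\<lambda>t. s (e * (t - t0))) \<longlongrightarrow> s (e * (t0 + e * l - t0)))
          (at (t0 + e * l) within {t. e * (t - t0) \<in> {0..l}})"
        by (rule continuous_on_def[THEN iffD1, THEN bspec, OF c]) (unfold mem_Collect_eq el, use l(1) in simp)
      then have "((\<lambda>t. s (e * (t - t0))) \<longlongrightarrow> s l) (at (t0 + e * l) within seg_disc t0 T r)"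
        unfolding el by (rule tendsto_within_subset) (auto simp: l(3))
      then have "((\<lambda>t. s (e * (t - t0)) powr \<beta>0) \<longlongrightarrow> s l powr \<beta>0) (at (t0 + e * l) within seg_disc t0 T r)"
        using s_pos[of l] l(1) by (intro tendsto_intros) auto
      then show "(\<phi> \<longlongrightarrow> s l powr \<beta>0) (at (t0 + e * l) within seg_disc t0 T r)"
      proof (rule Lim_transform_within[OF _ zero_less_one])
        fix x assume "x \<in> seg_disc t0 T r"
        then show "s (e * (x - t0)) powr \<beta>0 = \<phi> x"
          using \<phi>s[of "e * (x - t0)"] l(3)[of x] ee(1) by simp
      qed
    qed
  qed
qed

section \<open>Meromorphic continuation\<close>

lemma set_integral_finite_sum:
  fixes f :: "'i \<Rightarrow> 'a \<Rightarrow> 'b::{banach, second_countable_topology}"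
  assumes "\<And>i. i \<in> I \<Longrightarrow> set_integrable M A (f i)"
  shows "set_integrable M A (\<lambda>x. \<Sum>i\<in>I. f i x)"
    and "(LINT x:A|M. (\<Sum>i\<in>I. f i x)) = (\<Sum>i\<in>I. LINT x:A|M. f i x)"
  using assms by (simp_all add: set_integrable_def set_lebesgue_integral_def scaleR_sum_right)

lemma of_real_powr_powr:
  "0 < x \<Longrightarrow> complex_of_real (x powr \<beta>) powr \<gamma> = of_real x powr (of_real \<beta> * \<gamma>)"
  by (simp add: of_real_powr_exp_ln ln_powr mult_ac)

theorem theorem3p1:
  fixes t0 :: real and T :: ereal
    and \<phi> :: "real \<Rightarrow> real" and a :: "real \<Rightarrow> complex"
    and R :: real and \<alpha>0 :: complex and \<beta>0 :: real
    and q p :: "complex \<Rightarrow> complex"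
    and rp r\<phi> rb r0 r :: real and N :: nat
  assumes "T \<noteq> ereal t0"
    and "continuous_on (seg t0 T) \<phi>" and "\<forall>t \<in> seg t0 T. \<phi> t > 0"
    and "continuous_on (seg t0 T) a"
    and "condition_F t0 T \<phi> a R \<alpha>0 \<beta>0 q p"
    and "0 < rp" and "rp < R" and "\<forall>w \<in> disc t0 rp. p w \<noteq> 0"
    and "0 < r\<phi>" and "r\<phi> \<le> rp" and "inj_on (phi_P t0 T \<beta>0 p rp) (disc t0 r\<phi>)"
    and "0 < rb" and "rb < R" and "\<forall>w \<in> disc t0 rb. b_fun t0 \<beta>0 p w \<noteq> 0"
    and "0 < r0" and "r0 < Min {rp, rb, r\<phi>}"
    and "0 < r" and "r < r0"
    and "N \<ge> 1"
  shows
    "(\<forall>z. Re z < Re (chi_exp \<alpha>0 \<beta>0 0) \<longrightarrow>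
        set_integrable lborel (seg_disc t0 T r) (mellin_integrand \<phi> a z)) \<and>
     (\<forall>z. Re z < Re (chi_exp \<alpha>0 \<beta>0 N) \<longrightarrow>
        set_integrable lborel (seg_disc t0 T r)
          (mellin_rem_integrand t0 T \<phi> \<alpha>0 \<beta>0 q p rp r0 N z)) \<and>
     (\<exists>F. F meromorphic_on {z. Re z < Re (chi_exp \<alpha>0 \<beta>0 N)} \<and>
        (\<forall>z. Re z < Re (chi_exp \<alpha>0 \<beta>0 0) \<longrightarrow> F z = mellin t0 T \<phi> a r z) \<and>
        (\<forall>z \<in> {z. Re z < Re (chi_exp \<alpha>0 \<beta>0 N)} - chi_exp \<alpha>0 \<beta>0 ` {..<N}.
           F z = - exp (\<i> * of_real (seg_arg t0 T)) *
                   (\<Sum>n<N. coeff_c t0 T \<alpha>0 \<beta>0 q p rp r0 n *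
                      (of_real (phi_end t0 T \<phi> r) powr (chi_exp \<alpha>0 \<beta>0 n - z)) /
                      (z - chi_exp \<alpha>0 \<beta>0 n))
                 + mellin_rem t0 T \<phi> \<alpha>0 \<beta>0 q p rp r0 r N z) \<and>
        F analytic_on ({z. Re z < Re (chi_exp \<alpha>0 \<beta>0 N)} - chi_exp \<alpha>0 \<beta>0 ` {..<N}) \<and>
        (\<forall>n<N. (is_pole F (chi_exp \<alpha>0 \<beta>0 n) \<longrightarrow> zorder F (chi_exp \<alpha>0 \<beta>0 n) = -1) \<and>
           residue F (chi_exp \<alpha>0 \<beta>0 n) =
             - exp (\<i> * of_real (seg_arg t0 T)) * coeff_c t0 T \<alpha>0 \<beta>0 q p rp r0 n) \<and>
        (\<forall>\<sigma>. (\<lambda>z. norm (F z)) \<in>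
           O[inf (filtercomap (\<lambda>z. \<bar>Im z\<bar>) at_top)
                 (principal {z. \<sigma> \<le> Re z \<and> Re z < Re (chi_exp \<alpha>0 \<beta>0 N)})](\<lambda>z. 1 / norm z)))"
proof -
  define e where "e = seg_sign t0 T"
  define X where "X = chi_exp \<alpha>0 \<beta>0"
  define c where "c = coeff_c t0 T \<alpha>0 \<beta>0 q p rp r0"
  define H where "H = {z. Re z < Re (X N)}"
  define Rem where "Rem = mellin_rem t0 T \<phi> \<alpha>0 \<beta>0 q p rp r0 r N"
  have \<beta>0: "0 < \<beta>0" using assms(5) by (simp add: condition_F_def)
  have "r0 < r\<phi>" using assms(16) by simp
  note param = phi_P_local_parametrisation[OF assms(1,5-8,10,11,17,18) this, where N = N, folded e_def c_def]
  obtain l s s' and D D' :: "real \<Rightarrow> complex" where PS: "power_substitution s s' l"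
    and seg: "\<And>t. t \<in> seg_disc t0 T r \<longleftrightarrow> e * (t - t0) \<in> {0<..<l}"
    and D: "\<And>u. u \<in> {0..l} \<Longrightarrow> (D has_vector_derivative D' u) (at u within {0..l})"
      "continuous_on {0..l} D'"
    and \<phi>: "\<And>u. u \<in> {0<..<l} \<Longrightarrow> \<phi> (t0 + e * u) = s u powr \<beta>0"
      "\<And>u. u \<in> {0<..<l} \<Longrightarrow> deriv \<phi> (t0 + e * u) = e * \<beta>0 * s u powr (\<beta>0 - 1) * s' u"
      "\<And>u. u \<in> {0<..<l} \<Longrightarrow> phi_P t0 T \<beta>0 p rp (of_real (t0 + e * u)) = of_real (s u)"
      "\<And>u. u \<in> {0<..<l} \<Longrightarrow> remainder_C t0 T \<alpha>0 \<beta>0 q p rp r0 (t0 + e * u) N =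
           of_real (s u) ^ N * D u / of_real \<beta>0"
    and a: "\<And>u. u \<in> {0<..<l} \<Longrightarrow> a (t0 + e * u) =
           of_real (s u) powr \<alpha>0 * (of_real e * of_real (s' u) *
             ((\<Sum>n<N. of_real \<beta>0 * c n * of_real (s u) ^ n) + of_real (s u) ^ N * D u))"
    and phi_end: "phi_end t0 T \<phi> r = s l powr \<beta>0"
    by (rule param) (rule that; assumption)
  interpret power_substitution s s' l by (rule PS)
  define b where "b = s l powr \<beta>0"
  have sl: "0 < s l" using s_pos[of l] l_pos by simp
  then have b: "0 < b" by (simp add: b_def)
  have e: "\<bar>e\<bar> = 1" "exp (\<i> * of_real (seg_arg t0 T)) = complex_of_real e"
    by (auto simp: e_def exp_seg_arg seg_sign_def)
  \<comment> \<open>With \<open>w n z = \<beta> (\<chi> n - z)\<close>, the substituted integrands are \<open>s' s\<^sup>w\<^sup>-\<^sup>1\<close>, and \<open>Re (w n z) > 0\<close> is convergence at \<open>t\<^sub>0\<close>.\<close>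
  define w where "w = (\<lambda>n z. of_real \<beta>0 * (X n - z))"
  have w: "w n z = \<alpha>0 + of_nat n - of_real \<beta>0 * z + 1" for n z
    using \<beta>0 by (simp add: w_def X_def chi_exp_def field_simps)
  have Rew: "0 < Re (w n z)" if "Re z < Re (X n)" for n z
    using that \<beta>0 by (simp add: w_def)
  have ReX: "Re (X 0) \<le> Re (X n)" for n
    using \<beta>0 by (simp add: X_def chi_exp_def divide_right_mono)
  have contD: "continuous_on {0..l} D"
    using D(1) by (meson continuous_on_eq_continuous_within has_vector_derivative_continuous)
  have powers: "of_real (s u) powr (- (of_real \<beta>0 * z)) * (of_real (s u) powr \<alpha>0 * of_real (s u) ^ n)
      = of_real (s u) powr (w n z - 1)" if "u \<in> {0<..<l}" for u n z
  proof -
    have "complex_of_real (s u) \<noteq> 0" using s_pos[of u] that by auto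
    then show ?thesis
      unfolding w by (simp add: powr_diff powr_add powr_minus powr_nat' field_simps)
  qed
  define h where "h = (\<lambda>n z E u. of_real (s' u) * of_real (s u) powr (w n z - 1) * (E u :: complex))"
  have h_int: "set_integrable lborel {0<..<l} (h n z E)"
    if "continuous_on {0..l} E" "Re z < Re (X n)" for n z E
    unfolding h_def using Rew[OF that(2)] by (intro set_integrable_power that(1)) simp
  have mellin_eq: "mellin_integrand \<phi> a z (t0 + e * u) =
      of_real e * ((\<Sum>n<N. of_real \<beta>0 * c n * h n z (\<lambda>_. 1) u) + h N z D u)"
    if u: "u \<in> {0<..<l}" for u z
  proof -
    have s: "0 < s u" using s_pos[of u] u by auto
    have "mellin_integrand \<phi> a z (t0 + e * u) = of_real e * of_real (s' u) *
       ((\<Sum>n<N. of_real \<beta>0 * c n * (of_real (s u) powr (- (of_real \<beta>0 * z)) * (of_real (s u) powr \<alpha>0 * of_real (s u) ^ n)))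
         + of_real (s u) powr (- (of_real \<beta>0 * z)) * (of_real (s u) powr \<alpha>0 * of_real (s u) ^ N) * D u)"
      unfolding mellin_integrand_def \<phi>(1)[OF u] a[OF u] of_real_powr_powr[OF s]
      by (simp add: distrib_left sum_distrib_left mult_ac)
    then show ?thesis
      unfolding powers[OF u] h_def by (simp add: distrib_left sum_distrib_left mult_ac)
  qed
  have rem_eq: "mellin_rem_integrand t0 T \<phi> \<alpha>0 \<beta>0 q p rp r0 N z (t0 + e * u) = of_real e * h N z D u"
    if u: "u \<in> {0<..<l}" for u z
  proof -
    have s: "0 < s u" using s_pos[of u] u by auto
    have *: "of_real \<beta>0 * (chi_exp \<alpha>0 \<beta>0 0 - 1) = \<alpha>0 + of_real (1 - \<beta>0)"
      using \<beta>0 by (simp add: chi_exp_def field_simps)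
    have "complex_of_real (s u) powr (\<alpha>0 + of_real (1 - \<beta>0)) * of_real (s u powr (\<beta>0 - 1)) = of_real (s u) powr \<alpha>0"
      using s by (simp add: powr_def Ln_of_real exp_add[symmetric] exp_of_real[symmetric] algebra_simps)
    then have "mellin_rem_integrand t0 T \<phi> \<alpha>0 \<beta>0 q p rp r0 N z (t0 + e * u) = of_real e * of_real (s' u) *
        (of_real (s u) powr (- (of_real \<beta>0 * z)) * (of_real (s u) powr \<alpha>0 * of_real (s u) ^ N)) * D u"
      unfolding mellin_rem_integrand_def \<phi>[OF u] of_real_powr_powr[OF s] * using \<beta>0
      by (simp add: mult_ac)
    then show ?thesis
      unfolding powers[OF u] h_def by (simp add: mult_ac)
  qed
  note shift = set_integral_signed_shift[OF e(1) seg]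
  have mellin_int: "set_integrable lborel (seg_disc t0 T r) (mellin_integrand \<phi> a z)"
    and mellin_val: "mellin t0 T \<phi> a r z = of_real e *
      ((\<Sum>n<N. of_real \<beta>0 * c n * (of_real (s l) powr w n z / w n z)) + (LINT u:{0<..<l}|lborel. h N z D u))"
    if z: "Re z < Re (X 0)" for z
  proof -
    have zn: "Re z < Re (X n)" for n using z ReX[of n] by simp
    have i1: "set_integrable lborel {0<..<l} (\<lambda>u. of_real \<beta>0 * c n * h n z (\<lambda>_. 1) u)" for n
      using zn by (intro set_integrable_mult_right h_int continuous_on_const)
    note i = set_integral_finite_sum[of "{..<N}", OF i1] h_int[OF contD zn[of N]]
    have "set_integrable lborel {0<..<l} (\<lambda>u. of_real e * ((\<Sum>n<N. of_real \<beta>0 * c n * h n z (\<lambda>_. 1) u) + h N z D u))"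
      by (intro set_integrable_mult_right set_integral_add i)
    then show "set_integrable lborel (seg_disc t0 T r) (mellin_integrand \<phi> a z)"
      unfolding shift(1) by (subst set_integrable_cong[OF refl refl mellin_eq])
    have J: "(LINT u:{0<..<l}|lborel. h n z (\<lambda>_. 1) u) = of_real (s l) powr w n z / w n z" for n
      using power_integral_const[of "w n z - 1"] Rew[OF zn[of n]] by (simp add: h_def)
    have "mellin t0 T \<phi> a r z = (LINT u:{0<..<l}|lborel. of_real e * ((\<Sum>n<N. of_real \<beta>0 * c n * h n z (\<lambda>_. 1) u) + h N z D u))"
      unfolding mellin_def shift(2) by (intro set_lebesgue_integral_cong) (auto simp: mellin_eq)
    also have "\<dots> = of_real e * ((\<Sum>n<N. of_real \<beta>0 * c n * (LINT u:{0<..<l}|lborel. h n z (\<lambda>_. 1) u)) + (LINT u:{0<..<l}|lborel. h N z D u))"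
      by (simp add: set_integral_add(2)[OF i(1,3)] i(2))
    finally show "mellin t0 T \<phi> a r z = of_real e *
      ((\<Sum>n<N. of_real \<beta>0 * c n * (of_real (s l) powr w n z / w n z)) + (LINT u:{0<..<l}|lborel. h N z D u))"
      unfolding J .
  qed
  have rem_int: "set_integrable lborel (seg_disc t0 T r) (mellin_rem_integrand t0 T \<phi> \<alpha>0 \<beta>0 q p rp r0 N z)"
    if z: "Re z < Re (X N)" for z
    unfolding shift(1) using h_int[OF contD z]
    by (subst set_integrable_cong[OF refl refl rem_eq]) (auto intro: set_integrable_mult_right)
  have rem_val: "Rem z = of_real e * (LINT u:{0<..<l}|lborel. h N z D u)" for z
  proof -
    have "Rem z = (LINT u:{0<..<l}|lborel. of_real e * h N z D u)"
      unfolding Rem_def mellin_rem_def shift(2) by (intro set_lebesgue_integral_cong) (auto simp: rem_eq)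
    then show ?thesis by simp
  qed
  define I where "I = (\<lambda>v. integral {0..l} (\<lambda>u. of_real (s u) powr v * D' u))"
  have rem_parts: "Rem z = of_real e * ((of_real (s l) powr w N z * D l - I (w N z)) / w N z)"
    if "z \<in> H" for z
    unfolding rem_val h_def I_def using that Rew[of z N]
    by (subst power_integral_divided[OF D]) (auto simp: H_def)
  have H: "open H" unfolding H_def by (rule open_halfspace_Re_lt)
  have rem_hol: "Rem holomorphic_on H"
  proof -
    have wh: "w N holomorphic_on H" unfolding w_def by (intro holomorphic_intros)
    have "(I \<circ> w N) holomorphic_on H"
      using power_integral_holomorphic[OF D(2)] Rew
      by (intro holomorphic_on_compose_gen[OF wh]) (auto simp: I_def H_def)
    then have "(\<lambda>z. of_real e * ((of_real (s l) powr w N z * D l - I (w N z)) / w N z)) holomorphic_on H"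
      using Rew[of _ N] sl by (intro holomorphic_intros wh) (force simp: o_def H_def)+
    then show ?thesis by (rule holomorphic_transform) (simp add: rem_parts)
  qed
  \<comment> \<open>\<open>A n\<close> is the numerator of the \<open>n\<close>-th polar part; at \<open>z = \<chi> n\<close> the power of \<open>b\<close> is \<open>1\<close>, which leaves the residue.\<close>
  define A where "A = (\<lambda>n z. - of_real e * (c n * of_real b powr (X n - z)))"
  have A_hol: "A n holomorphic_on S" for n S
    unfolding A_def using b by (intro holomorphic_intros) auto
  \<comment> \<open>At the points \<open>\<chi> n\<close> this assigns an arbitrary finite value, which affects neither poles nor residues.\<close>
  define F where "F = (\<lambda>z. (\<Sum>n<N. A n z / (z - X n)) + Rem z)"
  have X_inj: "inj X"
    using \<beta>0 by (auto simp: X_def chi_exp_def inj_on_def divide_cancel_right)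
  have F_eq: "F z = - exp (\<i> * of_real (seg_arg t0 T)) *
       (\<Sum>n<N. c n * (of_real (phi_end t0 T \<phi> r) powr (X n - z)) / (z - X n)) + Rem z" for z
    unfolding F_def A_def e(2) phi_end b_def[symmetric] by (simp add: sum_distrib_left sum_negf)
  have F_mellin: "F z = mellin t0 T \<phi> a r z" if z: "Re z < Re (X 0)" for z
  proof -
    have "A n z / (z - X n) = of_real e * (of_real \<beta>0 * c n * (of_real (s l) powr w n z / w n z))" for n
    proof -
      have "z \<noteq> X n" using z ReX[of n] by auto
      then show ?thesis using \<beta>0 sl
        unfolding A_def b_def of_real_powr_powr[OF sl] w_def by (simp add: divide_simps) (simp add: algebra_simps)
    qed
    then show ?thesis
      unfolding F_def mellin_val[OF z] rem_val by (simp add: distrib_left sum_distrib_left)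
  qed
  have X_H: "X n \<in> H" if "n < N" for n
    using that \<beta>0 by (simp add: H_def X_def chi_exp_def divide_strict_right_mono)
  have A_X: "A n (X n) = - of_real e * c n" for n
    using b by (simp add: A_def)
  have pole: "residue F (X n) = - of_real e * c n" "is_pole F (X n) \<Longrightarrow> zorder F (X n) = -1" if n: "n < N" for n
  proof -
    note sp = simple_pole_of_sum[where \<xi> = X and A = A and N = N, OF H A_hol rem_hol X_inj n X_H[OF n], folded F_def]
    show "residue F (X n) = - of_real e * c n" using sp(1) by (simp add: A_X)
    show "is_pole F (X n) \<Longrightarrow> zorder F (X n) = -1" using sp(2) .
  qed
  have bigo: "(\<lambda>z. norm (F z)) \<in> O[strip_ends \<sigma> (Re (X N))](\<lambda>z. 1 / norm z)" for \<sigma>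
    unfolding F_def
  proof (intro bigo_norm_add bigo_norm_sum)
    fix n
    obtain C where C: "\<And>z. \<sigma> \<le> Re z \<Longrightarrow> Re z < Re (X N) \<Longrightarrow> norm (complex_of_real b powr (X n - z)) \<le> C"
      using norm_powr_bounded_strip[OF b] by blast
    have "norm (A n z / (z - X n)) \<le> norm (c n) * C / norm (z - X n)"
      if "\<sigma> \<le> Re z" "Re z < Re (X N)" for z
      using C[OF that] e(1) by (auto simp: A_def norm_mult norm_divide intro!: divide_right_mono mult_left_mono)
    then show "(\<lambda>z. norm (A n z / (z - X n))) \<in> O[strip_ends \<sigma> (Re (X N))](\<lambda>z. 1 / norm z)"
      by (rule bigo_divide_shift)
  next
    define B where "B = \<beta>0 * (Re (X N) - \<sigma>)"
    obtain M where M: "\<And>u v B. u \<in> {0..l} \<Longrightarrow> 0 \<le> Re v \<Longrightarrow> Re v \<le> B \<Longrightarrow>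
       norm (complex_of_real (s u) powr v) \<le> M powr B"
      by (rule norm_s_powr_bound) blast
    obtain C where C: "\<And>v \<delta>. 0 < Re v \<Longrightarrow> Re v \<le> B \<Longrightarrow> 0 \<le> \<delta> \<Longrightarrow> \<delta> \<le> l \<Longrightarrow>
      norm (integral {0..\<delta>} (\<lambda>u. of_real (s u) powr v * D' u)) \<le> C * \<delta>"
      using power_integral_bound[OF D(2)] by blast
    have "norm (Rem z) \<le> (M powr B * norm (D l) + C * l) / \<beta>0 / norm (z - X N)"
      if z: "\<sigma> \<le> Re z" "Re z < Re (X N)" for z
    proof -
      have v: "0 < Re (w N z)" "Re (w N z) \<le> B"
        using Rew[OF z(2)] z \<beta>0 by (auto simp: w_def B_def intro!: mult_left_mono)
      have "norm (Rem z) = norm (of_real (s l) powr w N z * D l - I (w N z)) / norm (w N z)"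
        using rem_parts[of z] z e(1) by (simp add: H_def norm_mult norm_divide)
      also have "norm (of_real (s l) powr w N z * D l - I (w N z)) \<le> M powr B * norm (D l) + C * l"
        using M[of l "w N z" B] C[of "w N z" l] v l_pos
        by (intro order_trans[OF norm_triangle_ineq4] add_mono) (auto simp: norm_mult I_def intro!: mult_right_mono)
      also have "norm (w N z) = \<beta>0 * norm (z - X N)"
        using \<beta>0 by (simp add: w_def norm_mult norm_minus_commute)
      finally show ?thesis by (simp add: divide_right_mono)
    qed
    then show "(\<lambda>z. norm (Rem z)) \<in> O[strip_ends \<sigma> (Re (X N))](\<lambda>z. 1 / norm z)"
      by (rule bigo_divide_shift)
  qed simp
  have mero: "F meromorphic_on H"
    unfolding F_def by (rule meromorphic_simple_poles[OF H A_hol rem_hol])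
  have ana: "F analytic_on (H - X ` {..<N})"
    unfolding F_def by (rule analytic_off_simple_poles[OF H A_hol rem_hol])
  show ?thesis
    unfolding X_def[symmetric] c_def[symmetric] Rem_def[symmetric] H_def[symmetric]
  proof (intro conjI exI[of _ F] allI impI ballI)
    show "F z = - exp (\<i> * of_real (seg_arg t0 T)) *
       (\<Sum>n<N. c n * (of_real (phi_end t0 T \<phi> r) powr (X n - z)) / (z - X n)) + Rem z" for z
      by (rule F_eq)
    show "residue F (X n) = - exp (\<i> * of_real (seg_arg t0 T)) * c n" if "n < N" for n
      using pole(1)[OF that] by (simp add: e(2))
  qed (use mellin_int rem_int mero ana F_mellin pole(2) bigo in auto)
qed

end
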